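(* Let $K$ be a connected isolated non-saddle set of a flow on a compact and connected ANR $M$ (in particular, on a compact and connected manifold) and let $L=M-\mathcal{I}(K)$ be the complement of its region of influence. Then $L$ is an isolated invariant compactum which is non-empty when $K$ is not an unstable global attractor. The saddle components of $L$ are exactly those containing externally dissonant points of $K$. The union of these components is an isolated invariant (saddle) compactum $L_s$, and $L-L_s$ is an isolated invariant non-saddle compactum, denoted $L_n$. Moreover, if $x$ is a non-homoclinic point in $\mathcal{I}(K)-K$ and the component of $\mathcal{I}(K)-K$ containing $x$ contains also homoclinic points, then either $\omega(x)\subset L_s$ or $\omega^*(x)\subset L_s$.
   Context: A flow is a continuous action $\varphi:M\times\mathbb{R}\to M$; write $xt=\varphi(x,t)$, $\gamma^+(x)=\{xt\mid t\ge 0\}$, $\gamma^-(x)=\{xt\mid t\le 0\}$, $\omega(x)=\bigcap_{t>0}\overline{x[t,\infty)}$, $\omega^*(x)=\bigcap_{t<0}\overline{x(-\infty,t]}$. ANR means absolute neighborhood retract (for metrizable spaces). An isolated invariant set is a compact invariant set $K$ having an isolating neighborhood, i.e. a compact neighborhood $N$ such that $K$ is the maximal invariant set in $N$. It is assumed that $\emptyset\neq K\subsetneq M$; the assertions that $L$, $L_s$, $L_n$ are isolated, saddle or non-saddle are understood for those of these sets which are non-empty. A compact invariant set $K$ is saddle if it admits a neighborhood $U$ such that every neighborhood $V$ of $K$ contains a point $x\in V$ with $\gamma^+(x)\nsubseteq U$ and $\gamma^-(x)\nsubseteq U$; otherwise it is non-saddle. A saddle component of $L$ is a connected component of $L$ which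 is a saddle set. $\mathcal{A}(K)=\{x\mid\emptyset\neq\omega(x)\subset K\}$, $\mathcal{R}(K)=\{x\mid\emptyset\neq\omega^*(x)\subset K\}$, $\mathcal{I}(K)=\mathcal{A}(K)\cup\mathcal{R}(K)$. Points of $\mathcal{H}(K)-K$, where $\mathcal{H}(K)=\mathcal{A}(K)\cap\mathcal{R}(K)$, are called homoclinic. $K$ is an unstable global attractor if $\mathcal{A}(K)=M$ and $K$ is not stable. For $x\in M$, $J^*(x)=\{(y,z)\in M\times M\mid \text{there are } x_n\to x,\ t_n\to\infty,\ s_n\to-\infty \text{ with } x_nt_n\to y,\ x_ns_n\to z\}$. A point $x\notin\mathcal{I}(K)$ is externally dissonant (for $K$) if $J^*(x)\cap(K\times K)\neq\emptyset$. *)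

theory Defs
  imports "HOL-Analysis.Analysis"
begin

text \<open>
  A metrizable space is an ANR if it is a neighbourhood retract in every metrizable space that
  contains it as a closed subset. HOL cannot quantify over the type carrying the ambient space
  \<open>Z\<close>; it is taken to be \<open>'a \<Rightarrow> real\<close>, which loses nothing: by the Kuratowski-Wojdyslawski theorem
  \<open>X\<close> is homeomorphic to a closed subset of a convex subset of the Banach space of bounded
  continuous functions on \<open>X\<close>, and by Dugundji's extension theorem being a neighbourhood retract
  there already yields a neighbourhood retraction in every metrizable ambient space. (The constant
  \<open>ANR\<close> of HOL-Analysis only tests ambient spaces inside \<open>'a \<times> real\<close> with the product topology,
  which is adequate for Euclidean \<open>'a\<close> only.)
\<close>

definition ANR_space :: "'a topology \<Rightarrow> bool" where
  "ANR_space X \<longleftrightarrow> metrizable_space X \<and>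
     (\<forall>(Z :: ('a \<Rightarrow> real) topology) A.
        metrizable_space Z \<and> closedin Z A \<and> X homeomorphic_space subtopology Z A \<longrightarrow>
        (\<exists>U. openin Z U \<and> A \<subseteq> U \<and> A retract_of_space subtopology Z U))"

text \<open>The phase space is the whole type; \<open>\<phi> x t\<close> is the point written \<open>xt\<close>.\<close>

definition flow :: "('a::topological_space \<Rightarrow> real \<Rightarrow> 'a) \<Rightarrow> bool" where
  "flow \<phi> \<longleftrightarrow> continuous_on UNIV (\<lambda>(x, t). \<phi> x t) \<and>
     (\<forall>x. \<phi> x 0 = x) \<and> (\<forall>x s t. \<phi> (\<phi> x s) t = \<phi> x (s + t))"

definition pos_orbit :: "('a \<Rightarrow> real \<Rightarrow> 'a) \<Rightarrow> 'a \<Rightarrow> 'a set" where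
  "pos_orbit \<phi> x = {\<phi> x t | t. t \<ge> 0}"

definition neg_orbit :: "('a \<Rightarrow> real \<Rightarrow> 'a) \<Rightarrow> 'a \<Rightarrow> 'a set" where
  "neg_orbit \<phi> x = {\<phi> x t | t. t \<le> 0}"

definition omega_limit :: "('a::topological_space \<Rightarrow> real \<Rightarrow> 'a) \<Rightarrow> 'a \<Rightarrow> 'a set" where
  "omega_limit \<phi> x = (\<Inter>t\<in>{0<..}. closure (\<phi> x ` {t..}))"

definition omega_star_limit :: "('a::topological_space \<Rightarrow> real \<Rightarrow> 'a) \<Rightarrow> 'a \<Rightarrow> 'a set" where
  "omega_star_limit \<phi> x = (\<Inter>t\<in>{..<0}. closure (\<phi> x ` {..t}))"

definition invariant :: "('a \<Rightarrow> real \<Rightarrow> 'a) \<Rightarrow> 'a set \<Rightarrow> bool" where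
  "invariant \<phi> S \<longleftrightarrow> (\<forall>x\<in>S. \<forall>t. \<phi> x t \<in> S)"

definition neighbourhood_of :: "'a::topological_space set \<Rightarrow> 'a set \<Rightarrow> bool" where
  "neighbourhood_of K U \<longleftrightarrow> K \<subseteq> interior U"

definition isolating_neighbourhood ::
    "('a::topological_space \<Rightarrow> real \<Rightarrow> 'a) \<Rightarrow> 'a set \<Rightarrow> 'a set \<Rightarrow> bool" where
  "isolating_neighbourhood \<phi> K N \<longleftrightarrow> compact N \<and> neighbourhood_of K N \<and>
     invariant \<phi> K \<and> (\<forall>S. S \<subseteq> N \<and> invariant \<phi> S \<longrightarrow> S \<subseteq> K)"

definition isolated_invariant :: "('a::topological_space \<Rightarrow> real \<Rightarrow> 'a) \<Rightarrow> 'a set \<Rightarrow> bool" where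
  "isolated_invariant \<phi> K \<longleftrightarrow>
     compact K \<and> invariant \<phi> K \<and> (\<exists>N. isolating_neighbourhood \<phi> K N)"

definition saddle :: "('a::topological_space \<Rightarrow> real \<Rightarrow> 'a) \<Rightarrow> 'a set \<Rightarrow> bool" where
  "saddle \<phi> K \<longleftrightarrow> compact K \<and> invariant \<phi> K \<and>
     (\<exists>U. neighbourhood_of K U \<and>
        (\<forall>V. neighbourhood_of K V \<longrightarrow>
           (\<exists>x\<in>V. \<not> pos_orbit \<phi> x \<subseteq> U \<and> \<not> neg_orbit \<phi> x \<subseteq> U)))"

definition non_saddle :: "('a::topological_space \<Rightarrow> real \<Rightarrow> 'a) \<Rightarrow> 'a set \<Rightarrow> bool" where
  "non_saddle \<phi> K \<longleftrightarrow> compact K \<and> invariant \<phi> K \<and> \<not> saddle \<phi> K"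

definition basin_of_attraction ::
    "('a::topological_space \<Rightarrow> real \<Rightarrow> 'a) \<Rightarrow> 'a set \<Rightarrow> 'a set" where
  "basin_of_attraction \<phi> K = {x. omega_limit \<phi> x \<noteq> {} \<and> omega_limit \<phi> x \<subseteq> K}"

definition basin_of_repulsion ::
    "('a::topological_space \<Rightarrow> real \<Rightarrow> 'a) \<Rightarrow> 'a set \<Rightarrow> 'a set" where
  "basin_of_repulsion \<phi> K = {x. omega_star_limit \<phi> x \<noteq> {} \<and> omega_star_limit \<phi> x \<subseteq> K}"

definition region_of_influence ::
    "('a::topological_space \<Rightarrow> real \<Rightarrow> 'a) \<Rightarrow> 'a set \<Rightarrow> 'a set" where
  "region_of_influence \<phi> K = basin_of_attraction \<phi> K \<union> basin_of_repulsion \<phi> K"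

definition homoclinic_points ::
    "('a::topological_space \<Rightarrow> real \<Rightarrow> 'a) \<Rightarrow> 'a set \<Rightarrow> 'a set" where
  "homoclinic_points \<phi> K = (basin_of_attraction \<phi> K \<inter> basin_of_repulsion \<phi> K) - K"

text \<open>Stability is meant in the sense of Lyapunov.\<close>

definition stable :: "('a::topological_space \<Rightarrow> real \<Rightarrow> 'a) \<Rightarrow> 'a set \<Rightarrow> bool" where
  "stable \<phi> K \<longleftrightarrow>
     (\<forall>U. neighbourhood_of K U \<longrightarrow>
        (\<exists>V. neighbourhood_of K V \<and> (\<forall>x\<in>V. pos_orbit \<phi> x \<subseteq> U)))"

definition unstable_global_attractor ::
    "('a::topological_space \<Rightarrow> real \<Rightarrow> 'a) \<Rightarrow> 'a set \<Rightarrow> bool" where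
  "unstable_global_attractor \<phi> K \<longleftrightarrow> basin_of_attraction \<phi> K = UNIV \<and> \<not> stable \<phi> K"

definition J_star ::
    "('a::topological_space \<Rightarrow> real \<Rightarrow> 'a) \<Rightarrow> 'a \<Rightarrow> ('a \<times> 'a) set" where
  "J_star \<phi> x = {(y, z). \<exists>xs t s. xs \<longlonglongrightarrow> x \<and>
     filterlim t at_top sequentially \<and> filterlim s at_bot sequentially \<and>
     (\<lambda>n. \<phi> (xs n) (t n)) \<longlonglongrightarrow> y \<and> (\<lambda>n. \<phi> (xs n) (s n)) \<longlonglongrightarrow> z}"

definition externally_dissonant ::
    "('a::topological_space \<Rightarrow> real \<Rightarrow> 'a) \<Rightarrow> 'a set \<Rightarrow> 'a \<Rightarrow> bool" where
  "externally_dissonant \<phi> K x \<longleftrightarrow>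
     x \<notin> region_of_influence \<phi> K \<and> J_star \<phi> x \<inter> (K \<times> K) \<noteq> {}"

definition saddle_components ::
    "('a::topological_space \<Rightarrow> real \<Rightarrow> 'a) \<Rightarrow> 'a set \<Rightarrow> 'a set set" where
  "saddle_components \<phi> L = {C \<in> components L. saddle \<phi> C}"

end

theory Submission
  imports Defs
begin

text \<open>
  Write \<open>A\<close> and \<open>R\<close> for the basins of attraction and repulsion of \<open>K\<close>, \<open>I = A \<union> R\<close>, and \<open>H\<close> for
  the set of homoclinic points. Since \<open>K\<close> is non-saddle, a point that is near \<open>K\<close> and has left an
  isolating neighbourhood in the past cannot leave it in the future, so it is attracted
  (\<open>attracted_if_returns\<close>). Consequently \<open>A - K\<close>, \<open>R - K\<close> and \<open>I\<close> are open, and a limit set that is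
  not inside \<open>K\<close> is inside \<open>L\<close>. Any compact neighbourhood of \<open>L\<close> that misses \<open>K\<close> isolates \<open>L\<close>, and
  similarly for each open and closed part of \<open>L\<close>.

  What happens near \<open>L\<close> is governed by one observation (\<open>stays_or_attracted\<close>): an orbit that passes
  close to an open and closed part \<open>P\<close> of \<open>L\<close> and afterwards leaves a neighbourhood of \<open>P\<close> does so
  near a point whose whole past is near \<open>P\<close>; that point is not in \<open>L\<close> and not in \<open>R\<close>, so it is in the
  open set \<open>A - K\<close>, and the given orbit goes to \<open>K\<close>. With the time-reversed statement, points near
  \<open>P\<close> that leave in both directions are homoclinic. Since the externally dissonant points are exactly
  the points of \<open>L \<inter> closure H\<close>, a component of \<open>L\<close> is saddle if and only if it contains one of them.

  It remains to see that the union \<open>L\<^sub>n\<close> of the components that miss \<open>closure H\<close> is open and closed in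
  \<open>L\<close>. Each of its points has an open and closed neighbourhood \<open>P\<close> in \<open>L\<close> that still misses
  \<open>closure H\<close>, and for such \<open>P\<close> the set of points outside \<open>P\<close> that tend to \<open>P\<close> is open and closed in
  \<open>I - K\<close>, again by the observation above; in one of the two time directions it is non-empty because
  the phase space is connected. But \<open>I - K\<close> has only finitely many components: some compact subset
  meets all its orbits, and an ANR is locally connected. So finitely many such \<open>P\<close> exhaust \<open>L\<^sub>n\<close>. The
  last assertion follows too: the basin of \<open>L\<^sub>n\<close> is a union of components of \<open>I - K\<close> without
  homoclinic points.

  All statements about backward time come from the forward ones by reversing the flow.
\<close>


section \<open>Limit sets of a flow on a compact space\<close>

locale compact_flow =
  fixes \<phi> :: "'a::metric_space \<Rightarrow> real \<Rightarrow> 'a"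
  assumes compact_space: "compact (UNIV :: 'a set)"
    and flow: "flow \<phi>"
begin

lemma compact_if_closed: "closed S \<Longrightarrow> compact (S :: 'a set)"
  using compact_Int_closed[OF compact_space] by simp

lemma flow_zero [simp]: "\<phi> x 0 = x"
  and flow_add: "\<phi> (\<phi> x s) t = \<phi> x (s + t)"
  using flow by (auto simp: flow_def)

lemma flow_cancel [simp]: "\<phi> (\<phi> x (- t)) t = x" "\<phi> (\<phi> x t) (- t) = x"
  by (simp_all add: flow_add)

lemma continuous_flow_pair: "continuous_on UNIV (\<lambda>p. \<phi> (fst p) (snd p))"
  using flow by (simp add: flow_def case_prod_beta)

lemma continuous_on_flow [continuous_intros]:
  assumes "continuous_on S f" "continuous_on S g"
  shows "continuous_on S (\<lambda>x. \<phi> (f x) (g x))"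
  using continuous_on_compose2[OF continuous_flow_pair continuous_on_Pair[OF assms]] by simp

lemma tendsto_flow [tendsto_intros]:
  assumes "(f \<longlongrightarrow> x) F" "(g \<longlongrightarrow> t) F"
  shows "((\<lambda>n. \<phi> (f n) (g n)) \<longlongrightarrow> \<phi> x t) F"
proof -
  have "isCont (\<lambda>p. \<phi> (fst p) (snd p)) (x, t)"
    using continuous_flow_pair by (simp add: continuous_on_eq_continuous_at)
  from isCont_tendsto_compose[OF this tendsto_Pair[OF assms]] show ?thesis by simp
qed

lemma open_flow_preimage: "open U \<Longrightarrow> open {x. \<phi> x t \<in> U}"
  and closed_flow_preimage: "closed U \<Longrightarrow> closed {x. \<phi> x t \<in> U}"
proof -
  have "continuous_on UNIV (\<lambda>x. \<phi> x t)" by (intro continuous_intros)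
  then show "open U \<Longrightarrow> open {x. \<phi> x t \<in> U}" "closed U \<Longrightarrow> closed {x. \<phi> x t \<in> U}"
    using open_vimage[of U "\<lambda>x. \<phi> x t"] closed_vimage[of U "\<lambda>x. \<phi> x t"]
    by (simp_all add: vimage_def)
qed

lemma invariant_iff: "invariant \<phi> S \<Longrightarrow> \<phi> x t \<in> S \<longleftrightarrow> x \<in> S"
  unfolding invariant_def by (metis flow_cancel(2))

lemma invariant_Diff: "invariant \<phi> S \<Longrightarrow> invariant \<phi> T \<Longrightarrow> invariant \<phi> (S - T)"
  by (auto simp: invariant_def invariant_iff)

lemma connected_orbit: "connected T \<Longrightarrow> connected (\<phi> x ` T)"
  by (intro connected_continuous_image continuous_intros)

lemma omega_limit_shift: "omega_limit \<phi> (\<phi> x s) = omega_limit \<phi> x"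
proof -
  have sub: "omega_limit \<phi> (\<phi> y r) \<subseteq> omega_limit \<phi> y" for y r
    unfolding omega_limit_def
  proof (intro INT_greatest)
    fix t :: real assume "t \<in> {0<..}"
    have "\<phi> (\<phi> y r) ` {t + \<bar>r\<bar>..} \<subseteq> \<phi> y ` {t..}"
      by (auto simp: flow_add)
    then have "closure (\<phi> (\<phi> y r) ` {t + \<bar>r\<bar>..}) \<subseteq> closure (\<phi> y ` {t..})"
      by (rule closure_mono)
    moreover have "t + \<bar>r\<bar> \<in> {0<..}" using \<open>t \<in> {0<..}\<close> by auto
    ultimately show "(\<Inter>t\<in>{0<..}. closure (\<phi> (\<phi> y r) ` {t..})) \<subseteq> closure (\<phi> y ` {t..})"
      by blast
  qed
  show ?thesis
    using sub[of x s] sub[of "\<phi> x s" "- s"] by auto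
qed

lemma omega_limit_in_open:
  assumes "open W" "omega_limit \<phi> x \<subseteq> W"
  shows "\<exists>T. \<forall>t\<ge>T. \<phi> x t \<in> W"
proof -
  let ?F = "\<lambda>t. closure (\<phi> x ` {t..})"
  have "compact (- W)" using assms by (intro compact_if_closed) auto
  moreover have "- W \<inter> (\<Inter>t\<in>{0<..}. ?F t) = {}"
    using assms(2) by (auto simp: omega_limit_def)
  ultimately obtain J where J: "J \<subseteq> {0<..}" "finite J" "- W \<inter> (\<Inter>t\<in>J. ?F t) = {}"
    using compact_imp_fip_image[of "- W" "{0<..}" ?F] by (metis closed_closure)
  define T where "T = Max (insert 1 J)"
  have T: "\<And>j. j \<in> J \<Longrightarrow> j \<le> T" using J(2) by (auto simp: T_def)
  have "\<phi> x t \<in> W" if "t \<ge> T" for t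
  proof -
    have "\<phi> x t \<in> ?F j" if "j \<in> J" for j
      using T[OF that] \<open>t \<ge> T\<close> by (intro subsetD[OF closure_subset]) auto
    then show ?thesis using J(3) by auto
  qed
  then show ?thesis by blast
qed

lemma omega_limit_nonempty: "omega_limit \<phi> x \<noteq> {}"
proof
  assume "omega_limit \<phi> x = {}"
  then show False using omega_limit_in_open[of "{}" x] by auto
qed

lemma omega_limit_subset_closed:
  assumes "closed S" "\<And>t. t \<ge> T \<Longrightarrow> \<phi> x t \<in> S"
  shows "omega_limit \<phi> x \<subseteq> S"
proof -
  have "omega_limit \<phi> x \<subseteq> closure (\<phi> x ` {max T 1..})"
    unfolding omega_limit_def by (intro INT_lower) auto
  also have "\<dots> \<subseteq> S" using assms by (intro closure_minimal) auto
  finally show ?thesis .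
qed

lemma omega_limit_frequently:
  assumes "y \<in> omega_limit \<phi> x" "open W" "y \<in> W"
  shows "\<exists>t\<ge>T. \<phi> x t \<in> W"
proof -
  have "y \<in> closure (\<phi> x ` {max T 1..})"
    using assms(1) unfolding omega_limit_def by auto
  then obtain z where "z \<in> \<phi> x ` {max T 1..}" "z \<in> W"
    using assms(2,3) closure_iff_nhds_not_empty[of y "\<phi> x ` {max T 1..}"] by blast
  then show ?thesis by auto
qed

lemma closed_omega_limit: "closed (omega_limit \<phi> x)"
  unfolding omega_limit_def by auto

lemma invariant_omega_limit: "invariant \<phi> (omega_limit \<phi> x)"
  unfolding invariant_def
proof (intro ballI allI, rule ccontr)
  fix y t assume y: "y \<in> omega_limit \<phi> x" and "\<phi> y t \<notin> omega_limit \<phi> x"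
  then obtain s where s: "\<phi> y t \<notin> closure (\<phi> x ` {s..})"
    unfolding omega_limit_def by auto
  define W where "W = {z. \<phi> z t \<in> - closure (\<phi> x ` {s..})}"
  have W: "open W" "y \<in> W"
    unfolding W_def using s open_flow_preimage[of "- closure (\<phi> x ` {s..})" t]
    by (simp_all add: open_Compl)
  obtain r where r: "r \<ge> s - t" "\<phi> x r \<in> W"
    using omega_limit_frequently[OF y W] by blast
  have "\<phi> (\<phi> x r) t \<in> \<phi> x ` {s..}" using r(1) by (auto simp: flow_add)
  from subsetD[OF closure_subset this] show False using r(2) by (simp add: W_def)
qed

lemma omega_limit_subset_invariant:
  assumes "closed S" "invariant \<phi> S" "x \<in> S"
  shows "omega_limit \<phi> x \<subseteq> S"
  using omega_limit_subset_closed[of S 0 x] assms by (simp add: invariant_def)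

text \<open>
  This is the form in which the connectedness of limit sets is used: the tail of the orbit is a
  connected subset of the union of two disjoint neighbourhoods.
\<close>

lemma omega_limit_cases_closed:
  assumes "closed S" "closed T" "S \<inter> T = {}" "omega_limit \<phi> x \<subseteq> S \<union> T"
  shows "omega_limit \<phi> x \<subseteq> S \<or> omega_limit \<phi> x \<subseteq> T"
proof -
  obtain U V where UV: "open U" "open V" "S \<subseteq> U" "T \<subseteq> V" "U \<inter> V = {}"
    using t4_space[OF assms(1-3)] by blast
  have "open (U \<union> V)" "omega_limit \<phi> x \<subseteq> U \<union> V" using UV assms(4) by blast+
  then obtain r where r: "\<forall>t\<ge>r. \<phi> x t \<in> U \<union> V"
    using omega_limit_in_open by blast
  have "connected (\<phi> x ` {r..})" by (rule connected_orbit) simp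
  moreover have "\<phi> x ` {r..} \<subseteq> U \<union> V" using r by auto
  ultimately have "U \<inter> \<phi> x ` {r..} = {} \<or> V \<inter> \<phi> x ` {r..} = {}"
    using connectedD[of "\<phi> x ` {r..}" U V] UV by blast
  then have "\<phi> x ` {r..} \<subseteq> - U \<or> \<phi> x ` {r..} \<subseteq> - V" by blast
  then have "omega_limit \<phi> x \<subseteq> - U \<or> omega_limit \<phi> x \<subseteq> - V"
    using omega_limit_subset_closed[of "- U" r x] omega_limit_subset_closed[of "- V" r x]
      UV(1,2) by auto
  then show ?thesis using assms(4) UV(3,4) by blast
qed

lemma basin_iff: "x \<in> basin_of_attraction \<phi> S \<longleftrightarrow> omega_limit \<phi> x \<subseteq> S"
  by (simp add: basin_of_attraction_def omega_limit_nonempty)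

lemma invariant_basin: "invariant \<phi> (basin_of_attraction \<phi> S)"
  by (auto simp: invariant_def basin_iff omega_limit_shift)

lemma pos_orbit_iff: "pos_orbit \<phi> x \<subseteq> S \<longleftrightarrow> (\<forall>t\<ge>0. \<phi> x t \<in> S)"
  by (auto simp: pos_orbit_def)

lemma neg_orbit_iff: "neg_orbit \<phi> x \<subseteq> S \<longleftrightarrow> (\<forall>t\<le>0. \<phi> x t \<in> S)"
  by (auto simp: neg_orbit_def)

text \<open>
  The time \<open>t\<close> is the first one outside the interior of \<open>N\<close>. As \<open>N\<close> is closed, the exit point is
  a frontier point that still belongs to \<open>N\<close>.
\<close>

lemma first_exit:
  assumes "closed N" "x \<in> interior N" "s \<ge> 0" "\<phi> x s \<notin> N"
  shows "\<exists>t. 0 \<le> t \<and> (\<forall>r\<in>{0..t}. \<phi> x r \<in> N) \<and> \<phi> x t \<notin> interior N"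
proof -
  define E where "E = {r. r \<ge> 0 \<and> \<phi> x r \<notin> interior N}"
  have sE: "s \<in> E" using assms(3,4) interior_subset by (auto simp: E_def)
  have bdd: "bdd_below E" unfolding E_def by (intro bdd_belowI[of _ 0]) auto
  have "closed E"
  proof -
    have "closed {r. \<phi> x r \<in> - interior N}"
      using closed_vimage[of "- interior N" "\<phi> x"] continuous_on_flow[of UNIV "\<lambda>_. x" "\<lambda>r. r"]
      by (simp add: vimage_def closed_Compl)
    then have "closed ({0..} \<inter> {r. \<phi> x r \<in> - interior N})" by (intro closed_Int) auto
    moreover have "{0..} \<inter> {r. \<phi> x r \<in> - interior N} = E" by (auto simp: E_def)
    ultimately show ?thesis by simp
  qed
  then have tE: "Inf E \<in> E" using sE bdd by (intro closed_contains_Inf) auto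
  have before: "\<phi> x r \<in> interior N" if "0 \<le> r" "r < Inf E" for r
  proof (rule ccontr)
    assume "\<phi> x r \<notin> interior N"
    then have "r \<in> E" using that(1) by (simp add: E_def)
    then show False using cInf_lower[OF _ bdd, of r] that(2) by simp
  qed
  have pos: "Inf E > 0" using tE assms(2) by (cases "Inf E = 0") (auto simp: E_def)
  have "\<phi> x r \<in> N" if "0 \<le> r" "r \<le> Inf E" for r
  proof -
    have "\<phi> x ` closure {0..<Inf E} \<subseteq> N"
      using subsetD[OF interior_subset before] assms(1)
      by (intro image_closure_subset continuous_on_flow continuous_intros) auto
    then show ?thesis using that pos by auto
  qed
  then show ?thesis using tE by (auto simp: E_def)
qed

end


section \<open>Time reversal\<close>

definition reverse_flow :: "('a \<Rightarrow> real \<Rightarrow> 'a) \<Rightarrow> 'a \<Rightarrow> real \<Rightarrow> 'a" where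
  "reverse_flow \<phi> x t = \<phi> x (- t)"

lemma flow_reverse: "flow \<phi> \<Longrightarrow> flow (reverse_flow \<phi>)"
proof -
  assume f: "flow \<phi>"
  then have c: "continuous_on UNIV (\<lambda>p. \<phi> (fst p) (snd p))"
    and g: "\<phi> x 0 = x" "\<phi> (\<phi> x s) t = \<phi> x (s + t)" for x s t
    by (simp_all add: flow_def case_prod_beta)
  have "continuous_on UNIV (\<lambda>p. (fst p, - snd p) :: 'a \<times> real)"
    by (intro continuous_intros)
  from continuous_on_compose2[OF c this]
  have "continuous_on UNIV (\<lambda>p. \<phi> (fst p) (- snd p))" by simp
  then show ?thesis
    by (simp add: flow_def reverse_flow_def case_prod_beta g)
qed

lemma reverse_image: "reverse_flow \<phi> x ` S = \<phi> x ` (uminus ` S)"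
  by (auto simp: reverse_flow_def image_image)

lemma pos_orbit_reverse: "pos_orbit (reverse_flow \<phi>) x = neg_orbit \<phi> x"
  and neg_orbit_reverse: "neg_orbit (reverse_flow \<phi>) x = pos_orbit \<phi> x"
proof -
  have "pos_orbit \<psi> x = \<psi> x ` {0..}" "neg_orbit \<psi> x = \<psi> x ` {..0}" for \<psi> :: "'a \<Rightarrow> real \<Rightarrow> 'a"
    by (auto simp: pos_orbit_def neg_orbit_def)
  then show "pos_orbit (reverse_flow \<phi>) x = neg_orbit \<phi> x"
    "neg_orbit (reverse_flow \<phi>) x = pos_orbit \<phi> x"
    by (simp_all add: reverse_image)
qed

lemma omega_limit_reverse: "omega_limit (reverse_flow \<phi>) x = omega_star_limit \<phi> x"
proof -
  have u: "{..<0} = uminus ` {0::real<..}" by simp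
  show ?thesis
    unfolding omega_limit_def omega_star_limit_def u image_image by (simp add: reverse_image)
qed

lemma omega_star_limit_reverse: "omega_star_limit (reverse_flow \<phi>) x = omega_limit \<phi> x"
proof -
  have u: "{0::real<..} = uminus ` {..<0}" by simp
  show ?thesis
    unfolding omega_limit_def omega_star_limit_def u image_image by (simp add: reverse_image)
qed

lemma invariant_reverse: "invariant (reverse_flow \<phi>) S \<longleftrightarrow> invariant \<phi> S"
proof -
  have "(\<forall>t. \<phi> x (- t) \<in> S) \<longleftrightarrow> (\<forall>t. \<phi> x t \<in> S)" for x
    by (rule iffI; rule allI) (drule_tac x = "- t" in spec, simp)+
  then show ?thesis by (simp add: invariant_def reverse_flow_def)
qed

lemma isolating_neighbourhood_reverse:
  "isolating_neighbourhood (reverse_flow \<phi>) S N \<longleftrightarrow> isolating_neighbourhood \<phi> S N"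
  by (simp add: isolating_neighbourhood_def invariant_reverse)

lemma isolated_invariant_reverse: "isolated_invariant (reverse_flow \<phi>) S \<longleftrightarrow> isolated_invariant \<phi> S"
  by (simp add: isolated_invariant_def isolating_neighbourhood_reverse invariant_reverse)

lemma non_saddle_reverse: "non_saddle (reverse_flow \<phi>) S \<longleftrightarrow> non_saddle \<phi> S"
  by (simp add: non_saddle_def saddle_def invariant_reverse pos_orbit_reverse neg_orbit_reverse conj_commute)

lemma basin_reverse:
  "basin_of_attraction (reverse_flow \<phi>) S = basin_of_repulsion \<phi> S"
  "basin_of_repulsion (reverse_flow \<phi>) S = basin_of_attraction \<phi> S"
  by (simp_all add: basin_of_attraction_def basin_of_repulsion_def omega_limit_reverse omega_star_limit_reverse)

lemma region_of_influence_reverse: "region_of_influence (reverse_flow \<phi>) S = region_of_influence \<phi> S"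
  and homoclinic_points_reverse: "homoclinic_points (reverse_flow \<phi>) S = homoclinic_points \<phi> S"
  by (auto simp: region_of_influence_def homoclinic_points_def basin_reverse)

lemmas reverse_simps = pos_orbit_reverse neg_orbit_reverse omega_limit_reverse
  omega_star_limit_reverse invariant_reverse isolating_neighbourhood_reverse
  isolated_invariant_reverse non_saddle_reverse basin_reverse region_of_influence_reverse
  homoclinic_points_reverse

lemma (in compact_flow) compact_flow_reverse: "compact_flow (reverse_flow \<phi>)"
  using compact_space flow by unfold_locales (auto intro: flow_reverse)


section \<open>The region of influence of an isolated non-saddle set\<close>

locale isolated_non_saddle = compact_flow \<phi> for \<phi> :: "'a::metric_space \<Rightarrow> real \<Rightarrow> 'a" +
  fixes K :: "'a set"
  assumes isolated: "isolated_invariant \<phi> K"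
    and non_saddle: "non_saddle \<phi> K"
    and nonempty: "K \<noteq> {}"
begin

abbreviation attracted :: "'a set" where "attracted \<equiv> basin_of_attraction \<phi> K"
abbreviation repelled :: "'a set" where "repelled \<equiv> basin_of_repulsion \<phi> K"
abbreviation homoclinic :: "'a set" where "homoclinic \<equiv> homoclinic_points \<phi> K"
abbreviation influence :: "'a set" where "influence \<equiv> region_of_influence \<phi> K"
abbreviation L :: "'a set" where "L \<equiv> UNIV - region_of_influence \<phi> K"

lemma isolated_non_saddle_reverse: "isolated_non_saddle (reverse_flow \<phi>) K"
  using compact_flow_reverse isolated non_saddle nonempty
  by (simp add: isolated_non_saddle_def isolated_non_saddle_axioms_def reverse_simps)

lemma influence_iff: "x \<in> influence \<longleftrightarrow> x \<in> attracted \<or> x \<in> repelled"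
  by (simp add: region_of_influence_def)

lemma homoclinic_iff: "x \<in> homoclinic \<longleftrightarrow> x \<in> attracted - K \<and> x \<in> repelled - K"
  by (auto simp: homoclinic_points_def)

lemma closed_K: "closed K" and invariant_K: "invariant \<phi> K"
  using isolated by (auto simp: isolated_invariant_def compact_imp_closed)

lemma K_subset_attracted: "K \<subseteq> attracted"
  using omega_limit_subset_invariant[OF closed_K invariant_K] by (auto simp: basin_iff)

lemma ex_isolating_neighbourhood:
  obtains N where "isolating_neighbourhood \<phi> K N" "closed N" "K \<subseteq> interior N"
  using isolated
  by (auto simp: isolated_invariant_def isolating_neighbourhood_def neighbourhood_of_def
      dest: compact_imp_closed)

lemma in_K_if_orbit_in_isolating:
  assumes "isolating_neighbourhood \<phi> K N" "\<forall>t. \<phi> x t \<in> N"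
  shows "x \<in> K"
proof -
  have "range (\<phi> x) \<subseteq> N" "invariant \<phi> (range (\<phi> x))"
    using assms(2) by (auto simp: invariant_def flow_add)
  then have "range (\<phi> x) \<subseteq> K"
    using assms(1) by (auto simp: isolating_neighbourhood_def)
  then show ?thesis using rangeI[of "\<phi> x" 0] by auto
qed

lemma attracted_if_pos_orbit_in_isolating:
  assumes "isolating_neighbourhood \<phi> K N" "\<forall>t\<ge>T. \<phi> x t \<in> N"
  shows "x \<in> attracted"
proof -
  have N: "closed N" using assms(1) by (auto simp: isolating_neighbourhood_def compact_imp_closed)
  have "omega_limit \<phi> x \<subseteq> N" using omega_limit_subset_closed[OF N] assms(2) by blast
  then have "omega_limit \<phi> x \<subseteq> K"
    using assms(1) invariant_omega_limit by (simp add: isolating_neighbourhood_def)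
  then show ?thesis by (simp add: basin_iff)
qed

lemmas repelled_if_neg_orbit_in_isolating =
  isolated_non_saddle.attracted_if_pos_orbit_in_isolating[OF isolated_non_saddle_reverse,
    unfolded reverse_simps reverse_flow_def]

lemma locally_one_sided:
  assumes "K \<subseteq> interior N"
  shows "\<exists>V. open V \<and> K \<subseteq> V \<and> (\<forall>x\<in>V. (\<forall>t\<ge>0. \<phi> x t \<in> N) \<or> (\<forall>t\<le>0. \<phi> x t \<in> N))"
proof -
  have "neighbourhood_of K N" using assms by (simp add: neighbourhood_of_def)
  moreover have "\<not> (\<exists>U. neighbourhood_of K U \<and> (\<forall>V. neighbourhood_of K V \<longrightarrow>
      (\<exists>x\<in>V. \<not> pos_orbit \<phi> x \<subseteq> U \<and> \<not> neg_orbit \<phi> x \<subseteq> U)))"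
    using non_saddle by (simp add: non_saddle_def saddle_def)
  ultimately obtain V where V: "neighbourhood_of K V"
    "\<forall>x\<in>V. pos_orbit \<phi> x \<subseteq> N \<or> neg_orbit \<phi> x \<subseteq> N" by metis
  show ?thesis
  proof (intro exI conjI ballI)
    show "open (interior V)" "K \<subseteq> interior V" using V(1) by (simp_all add: neighbourhood_of_def)
    fix x assume "x \<in> interior V"
    then have "x \<in> V" by (rule subsetD[OF interior_subset])
    then show "(\<forall>t\<ge>0. \<phi> x t \<in> N) \<or> (\<forall>t\<le>0. \<phi> x t \<in> N)"
      using V(2) unfolding pos_orbit_iff neg_orbit_iff by blast
  qed
qed

text \<open>
  This is how the non-saddle hypothesis is mostly used. A point near
  \<open>K\<close> whose past has left an isolating neighbourhood must keep its future inside, and an orbit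
  that stays inside forever is attracted by \<open>K\<close>. The time \<open>\<tau>\<close> of the excursion can be chosen the same
  for all points near \<open>x\<close>, which turns the statement into openness of \<open>attracted - K\<close>.
\<close>

lemma attracted_if_returns:
  assumes "x \<notin> K"
  shows "\<exists>U V \<tau>. open U \<and> x \<in> U \<and> open V \<and> K \<subseteq> V \<and>
    (\<forall>y\<in>U. \<forall>t\<ge>\<tau>. \<phi> y t \<in> V \<longrightarrow> y \<in> attracted - K)"
proof -
  obtain N where N: "isolating_neighbourhood \<phi> K N" "closed N" "K \<subseteq> interior N"
    by (rule ex_isolating_neighbourhood)
  obtain V where V: "open V" "K \<subseteq> V"
    "\<And>x. x \<in> V \<Longrightarrow> (\<forall>t\<ge>0. \<phi> x t \<in> N) \<or> (\<forall>t\<le>0. \<phi> x t \<in> N)"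
    using locally_one_sided[OF N(3)] by blast
  obtain \<tau> where \<tau>: "\<phi> x \<tau> \<notin> N" using assms in_K_if_orbit_in_isolating[OF N(1)] by blast
  define U where "U = {y. \<phi> y \<tau> \<in> - N}"
  have U: "open U" "x \<in> U"
    using open_flow_preimage[of "- N" \<tau>] N(2) \<tau> by (simp_all add: U_def open_Compl)
  have "y \<in> attracted - K" if y: "y \<in> U" and t: "t \<ge> \<tau>" "\<phi> y t \<in> V" for y t
  proof -
    have "\<phi> (\<phi> y t) (\<tau> - t) \<notin> N" using y by (simp add: flow_add U_def)
    moreover have "\<tau> - t \<le> 0" using t(1) by simp
    ultimately have "\<forall>s\<ge>0. \<phi> (\<phi> y t) s \<in> N" using V(3)[OF t(2)] by blast
    then have "\<phi> y t \<in> attracted" by (rule attracted_if_pos_orbit_in_isolating[OF N(1)])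
    then have "y \<in> attracted" using invariant_iff[OF invariant_basin] by blast
    moreover have "y \<notin> K"
      using y invariant_iff[OF invariant_K, of y \<tau>] N(3) interior_subset[of N] by (auto simp: U_def)
    ultimately show ?thesis by blast
  qed
  then show ?thesis using U V(1,2) by blast
qed

lemma attracted_if_omega_limit_meets:
  assumes "omega_limit \<phi> x \<inter> K \<noteq> {}"
  shows "x \<in> attracted"
proof (cases "x \<in> K")
  case False
  obtain U V \<tau> where UV: "x \<in> U" "open V" "K \<subseteq> V"
    "\<forall>y\<in>U. \<forall>t\<ge>\<tau>. \<phi> y t \<in> V \<longrightarrow> y \<in> attracted - K"
    using attracted_if_returns[OF False] by blast
  obtain y where y: "y \<in> omega_limit \<phi> x" "y \<in> V" using assms UV(3) by blast
  obtain t where "t \<ge> \<tau>" "\<phi> x t \<in> V" using omega_limit_frequently[OF y(1) UV(2) y(2)] by blast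
  then show ?thesis using UV by blast
qed (use K_subset_attracted in blast)

lemma open_attracted: "open (attracted - K)"
proof (rule topological_space_class.openI)
  fix x assume x: "x \<in> attracted - K"
  then obtain U V \<tau> where UV: "open U" "x \<in> U" "open V" "K \<subseteq> V"
    "\<forall>y\<in>U. \<forall>t\<ge>\<tau>. \<phi> y t \<in> V \<longrightarrow> y \<in> attracted - K"
    using attracted_if_returns[of x] by blast
  have "omega_limit \<phi> x \<subseteq> V" using x UV(4) by (auto simp: basin_iff)
  then obtain T where T: "\<forall>t\<ge>T. \<phi> x t \<in> V" using omega_limit_in_open[OF UV(3)] by blast
  let ?t = "max T \<tau>"
  have "open (U \<inter> {y. \<phi> y ?t \<in> V})" using UV(1,3) open_flow_preimage by blast
  moreover have "x \<in> U \<inter> {y. \<phi> y ?t \<in> V}" using UV(2) T by simp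
  moreover have "U \<inter> {y. \<phi> y ?t \<in> V} \<subseteq> attracted - K"
  proof
    fix y assume "y \<in> U \<inter> {y. \<phi> y ?t \<in> V}"
    then show "y \<in> attracted - K" using UV(5)[rule_format, of y ?t] by simp
  qed
  ultimately show "\<exists>T. open T \<and> x \<in> T \<and> T \<subseteq> attracted - K" by blast
qed

lemmas open_repelled =
  isolated_non_saddle.open_attracted[OF isolated_non_saddle_reverse, unfolded reverse_simps]

lemma open_influence: "open influence"
proof -
  obtain N where N: "isolating_neighbourhood \<phi> K N" "K \<subseteq> interior N"
    by (rule ex_isolating_neighbourhood)
  obtain V where V: "open V" "K \<subseteq> V"
    "\<And>x. x \<in> V \<Longrightarrow> (\<forall>t\<ge>0. \<phi> x t \<in> N) \<or> (\<forall>t\<le>0. \<phi> x t \<in> N)"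
    using locally_one_sided[OF N(2)] by blast
  have "x \<in> influence" if x: "x \<in> V" for x
  proof -
    consider "\<forall>t\<ge>0. \<phi> x t \<in> N" | "\<forall>t\<le>0. \<phi> x t \<in> N"
      using V(3)[OF x] by blast
    then show ?thesis
    proof cases
      case 1
      then show ?thesis
        using attracted_if_pos_orbit_in_isolating[OF N(1)] by (simp add: influence_iff)
    next
      case 2
      then have "\<forall>t\<ge>0. \<phi> x (- t) \<in> N" by simp
      then show ?thesis
        using repelled_if_neg_orbit_in_isolating[OF N(1)] by (simp add: influence_iff)
    qed
  qed
  then have "influence = V \<union> (attracted - K) \<union> (repelled - K)"
    using V(2) by (auto simp: influence_iff)
  then show ?thesis using open_attracted open_repelled V(1) by (metis open_Un)
qed

lemma invariant_influence: "invariant \<phi> influence"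
  using invariant_basin[of K]
    compact_flow.invariant_basin[OF compact_flow_reverse, of K, unfolded reverse_simps]
  by (auto simp: invariant_def influence_iff)

lemma invariant_L: "invariant \<phi> L"
  using invariant_influence invariant_Diff[of UNIV influence] by (simp add: invariant_def)

lemma closed_L: "closed L"
  using open_influence by (simp add: closed_Diff)

lemma L_disjoint_K: "L \<inter> K = {}"
  using K_subset_attracted by (auto simp: influence_iff)

text \<open>
  A limit set that meets the region of influence contains a limit set inside \<open>K\<close>, hence meets
  \<open>K\<close>.
\<close>

lemma omega_limit_subset_L:
  assumes "x \<notin> attracted"
  shows "omega_limit \<phi> x \<subseteq> L"
proof
  fix y assume y: "y \<in> omega_limit \<phi> x"
  have disj: "omega_limit \<phi> x \<inter> K = {}" using assms attracted_if_omega_limit_meets by blast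
  have "omega_limit \<phi> y \<subseteq> omega_limit \<phi> x"
    by (rule omega_limit_subset_invariant[OF closed_omega_limit invariant_omega_limit y])
  moreover have "omega_star_limit \<phi> y \<subseteq> omega_limit \<phi> x"
    using compact_flow.omega_limit_subset_invariant[OF compact_flow_reverse, unfolded reverse_simps,
        OF closed_omega_limit invariant_omega_limit y] .
  moreover have "omega_limit \<phi> y \<noteq> {}" "omega_star_limit \<phi> y \<noteq> {}"
    using omega_limit_nonempty
      compact_flow.omega_limit_nonempty[OF compact_flow_reverse, unfolded reverse_simps] .
  ultimately have "y \<notin> influence"
    using disj unfolding influence_iff basin_of_attraction_def basin_of_repulsion_def by blast
  then show "y \<in> L" by blast
qed

lemma omega_limit_cases_influence: "omega_limit \<phi> x \<subseteq> K \<or> omega_limit \<phi> x \<subseteq> L"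
  using omega_limit_subset_L[of x] by (auto simp: basin_iff)

text \<open>
  If \<open>L\<close> is empty, all forward limit sets lie in \<open>K\<close>, which is then a global attractor. It cannot
  be stable unless it is the whole space: every backward limit set is closed and invariant and thus
  contains forward limit sets, so it meets \<open>K\<close>, and stability would keep the orbit of a point
  outside \<open>K\<close> from ever returning to that point after passing near \<open>K\<close>.
\<close>

lemma L_nonempty:
  assumes "K \<noteq> UNIV" "\<not> unstable_global_attractor \<phi> K"
  shows "L \<noteq> {}"
proof
  assume "L = {}"
  then have global: "attracted = UNIV"
    using omega_limit_subset_L omega_limit_nonempty by blast
  with assms(2) have stable: "stable \<phi> K" by (simp add: unstable_global_attractor_def)
  obtain x where x: "x \<notin> K" using assms(1) by blast
  interpret rev: compact_flow "reverse_flow \<phi>" by (rule compact_flow_reverse)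
  obtain y where y: "y \<in> omega_star_limit \<phi> x"
    using rev.omega_limit_nonempty unfolding reverse_simps by blast
  have "omega_limit \<phi> y \<subseteq> omega_star_limit \<phi> x"
    using omega_limit_subset_invariant y rev.closed_omega_limit rev.invariant_omega_limit
    unfolding reverse_simps by blast
  moreover have "omega_limit \<phi> y \<subseteq> K" "omega_limit \<phi> y \<noteq> {}"
    using global omega_limit_nonempty by (auto simp flip: basin_iff)
  ultimately obtain z where z: "z \<in> omega_star_limit \<phi> x" "z \<in> K" by blast
  have "neighbourhood_of K (- {x})" using x by (auto simp: neighbourhood_of_def interior_open[OF open_Compl[OF closed_singleton]])
  then obtain V where V: "neighbourhood_of K V" "\<forall>x'\<in>V. pos_orbit \<phi> x' \<subseteq> - {x}"
    using stable unfolding stable_def by blast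
  have "z \<in> interior V" using z(2) V(1) by (auto simp: neighbourhood_of_def)
  then obtain t where t: "t \<ge> 0" "reverse_flow \<phi> x t \<in> interior V"
    using rev.omega_limit_frequently[of z x "interior V" 0] z(1) unfolding reverse_simps by auto
  then have "pos_orbit \<phi> (\<phi> x (- t)) \<subseteq> - {x}"
    using V(2) interior_subset[of V] by (auto simp: reverse_flow_def)
  then have "\<phi> (\<phi> x (- t)) t \<in> - {x}" using t(1) unfolding pos_orbit_iff by blast
  then show False by simp
qed

end


section \<open>Open and closed parts of a compact set\<close>

definition clopen_part :: "'a::topological_space set \<Rightarrow> 'a set \<Rightarrow> bool" where
  "clopen_part S P \<longleftrightarrow> P \<subseteq> S \<and> closed P \<and> closed (S - P)"

lemma clopen_part_Compl: "clopen_part S P \<Longrightarrow> clopen_part S (S - P)"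
  by (simp add: clopen_part_def double_diff)

lemma clopen_part_Un:
  assumes "clopen_part S P" "clopen_part S Q"
  shows "clopen_part S (P \<union> Q)"
proof -
  have "S - (P \<union> Q) = (S - P) \<inter> (S - Q)" by blast
  then show ?thesis using assms by (simp add: clopen_part_def closed_Int closed_Un)
qed

lemma clopen_part_empty: "closed S \<Longrightarrow> clopen_part S {}"
  by (simp add: clopen_part_def)

lemma clopen_part_UN:
  assumes "closed S" "finite F" "\<And>i. i \<in> F \<Longrightarrow> clopen_part S (f i)"
  shows "clopen_part S (\<Union>i\<in>F. f i)"
  using assms(2,3)
  by (induction F rule: finite_induct) (auto intro: clopen_part_empty clopen_part_Un assms(1))

lemma clopen_part_Diff:
  assumes "clopen_part S P" "clopen_part S Q"
  shows "clopen_part S (P - Q)"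
proof -
  have "P - Q = S - ((S - P) \<union> Q)" using assms by (auto simp: clopen_part_def)
  then show ?thesis using assms clopen_part_Compl clopen_part_Un by metis
qed

lemma connected_subset_clopen_part:
  assumes "clopen_part S P" "connected C" "C \<subseteq> S" "x \<in> C" "x \<in> P"
  shows "C \<subseteq> P"
proof -
  have "P \<inter> C = {} \<or> (S - P) \<inter> C = {}"
    using assms by (intro connected_closedD) (auto simp: clopen_part_def)
  then show ?thesis using assms by blast
qed

lemma in_some_component: "x \<in> S \<Longrightarrow> \<exists>C\<in>components S. x \<in> C"
  by (metis UnionE Union_components)

text \<open>
  In a compact Hausdorff space components coincide with quasi-components, so a component has a
  neighbourhood base of open and closed sets.
\<close>

lemma component_clopen_part:
  fixes S :: "'a::metric_space set"
  assumes S: "compact S" and C: "C \<in> components S" and W: "open W" "C \<subseteq> W"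
  shows "\<exists>P. clopen_part S P \<and> C \<subseteq> P \<and> P \<subseteq> W"
proof -
  let ?X = "top_of_set S"
  have clC: "closedin ?X C"
    using closed_components[OF compact_imp_closed[OF S] C] in_components_subset[OF C]
      closed_subset by blast
  have clW: "closedin ?X (S - W)"
    using W(1) compact_imp_closed[OF S] by (intro closed_subset) auto
  have "separated_between ?X C (S - W)"
  proof (rule cut_wire_fence_theorem)
    show "compact_space ?X" "Hausdorff_space ?X"
      using S by (simp_all add: compact_space_subtopology Hausdorff_space_subtopology)
    show "disjnt D C \<or> disjnt D (S - W)" if "connectedin ?X D" for D
    proof -
      have "connected D" "D \<subseteq> S" using that by (auto simp: connectedin_subtopology)
      then have "D \<subseteq> C" if "C \<inter> D \<noteq> {}" using components_maximal[OF C] that by blast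
      then show ?thesis using W(2) by (auto simp: disjnt_def)
    qed
  qed (use clC clW in auto)
  then obtain P Q where PQ: "closedin ?X P" "closedin ?X Q" "P \<union> Q = S" "disjnt P Q"
    "C \<subseteq> P" "S - W \<subseteq> Q"
    unfolding separated_between_alt by auto
  then have "Q = S - P" by (auto simp: disjnt_def)
  moreover have "closed P" "closed Q"
    using PQ(1,2) closedin_closed_trans compact_imp_closed[OF S] by blast+
  ultimately have "clopen_part S P" using PQ(3) by (auto simp: clopen_part_def)
  moreover have "P \<subseteq> W" using PQ \<open>Q = S - P\<close> by blast
  ultimately show ?thesis using PQ(5) by blast
qed


section \<open>Passing near the complement of the region of influence\<close>

context isolated_non_saddle
begin

lemma invariant_clopen_part:
  assumes "clopen_part L P"
  shows "invariant \<phi> P"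
  unfolding invariant_def
proof (intro ballI allI)
  fix x t assume x: "x \<in> P"
  have "range (\<phi> x) \<subseteq> L" using assms x invariant_L by (auto simp: clopen_part_def invariant_def)
  moreover have "x \<in> range (\<phi> x)" using rangeI[of "\<phi> x" 0] by simp
  ultimately have "range (\<phi> x) \<subseteq> P"
    using connected_subset_clopen_part[OF assms connected_orbit[OF connected_UNIV]] x by blast
  then show "\<phi> x t \<in> P" by blast
qed

lemma omega_limit_cases:
  assumes "clopen_part L P"
  shows "omega_limit \<phi> x \<subseteq> K \<or> omega_limit \<phi> x \<subseteq> P \<or> omega_limit \<phi> x \<subseteq> L - P"
proof -
  have "omega_limit \<phi> x \<subseteq> P \<or> omega_limit \<phi> x \<subseteq> L - P" if "omega_limit \<phi> x \<subseteq> L"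
    using assms that by (intro omega_limit_cases_closed) (auto simp: clopen_part_def)
  then show ?thesis using omega_limit_cases_influence[of x] by blast
qed

lemma clopen_part_neighbourhood:
  assumes P: "clopen_part L P" and W: "open W" "P \<subseteq> W"
  shows "\<exists>N. closed N \<and> P \<subseteq> interior N \<and> N \<subseteq> W \<and> N \<inter> L = P \<and> N \<inter> K = {}"
proof -
  have cl: "closed P" "closed (- W \<union> (L - P) \<union> K)"
    using P W closed_K by (auto simp: clopen_part_def)
  have "P \<inter> (- W \<union> (L - P) \<union> K) = {}"
    using P W L_disjoint_K by (auto simp: clopen_part_def)
  from t4_space[OF cl this] obtain U V where UV: "open U" "open V" "P \<subseteq> U"
    "- W \<union> (L - P) \<union> K \<subseteq> V" "U \<inter> V = {}" by blast
  have "U \<subseteq> interior (- V)" using UV by (intro interior_maximal) auto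
  moreover have "- V \<inter> L = P" using UV P by (auto simp: clopen_part_def)
  ultimately show ?thesis using UV by (intro exI[of _ "- V"]) auto
qed

lemma not_attracted_if_tail_avoids_K:
  assumes "closed N" "N \<inter> K = {}" "\<forall>t\<ge>T. \<phi> x t \<in> N"
  shows "x \<notin> attracted"
proof
  assume "x \<in> attracted"
  then have "omega_limit \<phi> x \<subseteq> K" by (simp add: basin_iff)
  moreover have "omega_limit \<phi> x \<subseteq> N" using omega_limit_subset_closed[OF assms(1)] assms(3) by blast
  ultimately show False using assms(2) omega_limit_nonempty[of x] by blast
qed

lemmas not_repelled_if_tail_avoids_K =
  isolated_non_saddle.not_attracted_if_tail_avoids_K[OF isolated_non_saddle_reverse,
    unfolded reverse_simps reverse_flow_def]

lemma isolated_clopen_part: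
  assumes P: "clopen_part L P"
  shows "isolated_invariant \<phi> P"
proof -
  obtain N where N: "closed N" "P \<subseteq> interior N" "N \<inter> L = P" "N \<inter> K = {}"
    using clopen_part_neighbourhood[OF P open_UNIV] by blast
  have "S \<subseteq> P" if S: "S \<subseteq> N" "invariant \<phi> S" for S
  proof
    fix x assume x: "x \<in> S"
    then have orbit: "\<phi> x t \<in> N" for t using S by (auto simp: invariant_def)
    have "x \<notin> attracted" using not_attracted_if_tail_avoids_K[OF N(1,4)] orbit by blast
    moreover have "x \<notin> repelled" using not_repelled_if_tail_avoids_K[OF N(1,4)] orbit by blast
    ultimately show "x \<in> P" using x S(1) N(3) by (auto simp: influence_iff)
  qed
  then show ?thesis
    using P N invariant_clopen_part[OF P]
    by (auto simp: isolated_invariant_def isolating_neighbourhood_def neighbourhood_of_def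
        clopen_part_def intro: compact_if_closed)
qed

text \<open>
  Orbits that start near one staying in the interior of \<open>N\<close> either stay in \<open>N\<close> or are attracted
  by \<open>K\<close>. Otherwise there are points \<open>z n\<close> converging to \<open>y\<close> that leave \<open>N\<close>; a limit point \<open>l\<close> of
  the exit points has its whole past in \<open>N\<close>, as the exit times tend to infinity. So \<open>l\<close> is not
  repelled by \<open>K\<close>, and being a frontier point of \<open>N\<close> it is outside \<open>L\<close>. Hence \<open>l\<close> is attracted,
  and so are the nearby exit points because \<open>attracted - K\<close> is open.
\<close>

lemma stays_or_attracted:
  assumes N: "closed N" "N \<inter> K = {}" "N \<inter> L \<subseteq> interior N"
    and y: "\<forall>t\<ge>0. \<phi> y t \<in> interior N"
  shows "\<exists>U. open U \<and> y \<in> U \<and> (\<forall>z\<in>U. (\<forall>t\<ge>0. \<phi> z t \<in> N) \<or> z \<in> attracted - K)"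
proof (rule ccontr)
  assume neg: "\<not> ?thesis"
  have "y \<in> interior N" using y[rule_format, of 0] by simp
  have "\<exists>z. dist z y < 1 / real (Suc n) \<and> z \<in> interior N \<and> (\<exists>s\<ge>0. \<phi> z s \<notin> N) \<and> z \<notin> attracted - K"
    for n
  proof -
    have "open (ball y (1 / real (Suc n)) \<inter> interior N)"
      "y \<in> ball y (1 / real (Suc n)) \<inter> interior N"
      using \<open>y \<in> interior N\<close> by auto
    then obtain z where "z \<in> ball y (1 / real (Suc n)) \<inter> interior N"
      "\<not> (\<forall>t\<ge>0. \<phi> z t \<in> N)" "z \<notin> attracted - K" using neg by metis
    then show ?thesis by (intro exI[of _ z]) (auto simp: dist_commute)
  qed
  then obtain z where z: "\<And>n. dist (z n) y < 1 / real (Suc n)" "\<And>n. z n \<in> interior N"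
    "\<And>n. \<exists>s\<ge>0. \<phi> (z n) s \<notin> N" "\<And>n. z n \<notin> attracted - K" by metis
  have lim_z: "z \<longlonglongrightarrow> y"
  proof (rule metric_tendsto_imp_tendsto)
    show "(\<lambda>n. 1 / real (Suc n)) \<longlonglongrightarrow> 0" by (rule LIMSEQ_Suc[OF lim_1_over_n])
    show "\<forall>\<^sub>F n in sequentially. dist (z n) y \<le> dist (1 / real (Suc n)) 0"
      using z(1) by (intro always_eventually allI) (simp add: less_imp_le)
  qed
  have "\<exists>t. 0 \<le> t \<and> (\<forall>r\<in>{0..t}. \<phi> (z n) r \<in> N) \<and> \<phi> (z n) t \<notin> interior N" for n
    using z(3)[of n] first_exit[OF N(1) z(2)[of n]] by blast
  then obtain t where t: "\<And>n. 0 \<le> t n" "\<And>n. \<forall>r\<in>{0..t n}. \<phi> (z n) r \<in> N"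
    "\<And>n. \<phi> (z n) (t n) \<notin> interior N" by metis
  obtain l r where r: "strict_mono r" and l: "(\<lambda>n. \<phi> (z (r n)) (t (r n))) \<longlonglongrightarrow> l"
    using compact_space[unfolded compact_def, simplified, THEN spec, of "\<lambda>n. \<phi> (z n) (t n)"]
    by (auto simp: o_def)
  have lim_zr: "(\<lambda>n. z (r n)) \<longlonglongrightarrow> y" using LIMSEQ_subseq_LIMSEQ[OF lim_z r] by (simp add: o_def)
  have past: "\<phi> l (- s) \<in> N" if "s \<ge> 0" for s
  proof (rule Lim_in_closed_set[OF N(1)])
    let ?W = "{p. \<phi> (fst p) (snd p) \<in> interior N}"
    have W: "open ?W"
      using open_vimage[OF open_interior continuous_flow_pair] by (simp add: vimage_def)
    have "{y} \<times> {0..s} \<subseteq> ?W" using y by auto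
    from Elementary_Topology.tube_lemma[OF compact_Icc W this]
    obtain X where X: "y \<in> X" "open X" "X \<times> {0..s} \<subseteq> ?W" by blast
    have "\<forall>\<^sub>F n in sequentially. z (r n) \<in> X"
      using lim_zr X(2,1) by (rule topological_tendstoD)
    then show "\<forall>\<^sub>F n in sequentially. \<phi> (\<phi> (z (r n)) (t (r n))) (- s) \<in> N"
    proof (rule eventually_mono)
      fix n assume "z (r n) \<in> X"
      then have "t (r n) \<notin> {0..s}" using subsetD[OF X(3), of "(z (r n), t (r n))"] t(3)[of "r n"] by auto
      then have "t (r n) - s \<in> {0..t (r n)}" using t(1)[of "r n"] that by auto
      then show "\<phi> (\<phi> (z (r n)) (t (r n))) (- s) \<in> N"
        using t(2)[of "r n"] by (simp add: flow_add)
    qed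
    show "(\<lambda>n. \<phi> (\<phi> (z (r n)) (t (r n))) (- s)) \<longlonglongrightarrow> \<phi> l (- s)"
      by (intro tendsto_flow l tendsto_const)
  qed simp
  have "l \<in> N" using past[of 0] by simp
  have "l \<in> - interior N"
    using t(3) by (intro Lim_in_closed_set[OF _ _ _ l]) (auto simp: closed_Compl)
  then have "l \<notin> L" using \<open>l \<in> N\<close> N(3) by blast
  moreover have "l \<notin> repelled"
    using not_repelled_if_tail_avoids_K[OF N(1,2)] past by blast
  ultimately have "l \<in> attracted - K" using \<open>l \<in> N\<close> N(2) by (auto simp: influence_iff)
  then have "\<forall>\<^sub>F n in sequentially. \<phi> (z (r n)) (t (r n)) \<in> attracted - K"
    using topological_tendstoD[OF l open_attracted] by blast
  then obtain n where "\<phi> (z (r n)) (t (r n)) \<in> attracted - K"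
    using eventually_happens by fastforce
  then have "z (r n) \<in> attracted - K"
    using invariant_iff[OF invariant_Diff[OF invariant_basin invariant_K]] by blast
  then show False using z(4) by blast
qed

lemmas stays_or_repelled =
  isolated_non_saddle.stays_or_attracted[OF isolated_non_saddle_reverse,
    unfolded reverse_simps reverse_flow_def]

text \<open>
  The union with \<open>attracted - K\<close> is what makes the basin open: a point near the basin that fails
  to follow its orbit to \<open>P\<close> is attracted by \<open>K\<close>. Equivalently, which open and closed part of
  \<open>L\<close> contains the limit set is a continuous function of the points not attracted by \<open>K\<close>.
\<close>

lemma open_basin_clopen_part:
  assumes P: "clopen_part L P"
  shows "open (basin_of_attraction \<phi> P \<union> (attracted - K))"
proof (rule topological_space_class.openI)
  fix x assume x: "x \<in> basin_of_attraction \<phi> P \<union> (attracted - K)"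
  show "\<exists>T. open T \<and> x \<in> T \<and> T \<subseteq> basin_of_attraction \<phi> P \<union> (attracted - K)"
  proof (cases "x \<in> attracted - K")
    case True
    then show ?thesis using open_attracted by blast
  next
    case False
    then have \<omega>: "omega_limit \<phi> x \<subseteq> P" using x by (auto simp: basin_iff)
    obtain N where N: "closed N" "P \<subseteq> interior N" "N \<inter> L = P" "N \<inter> K = {}"
      using clopen_part_neighbourhood[OF P open_UNIV] by blast
    have "omega_limit \<phi> x \<subseteq> interior N" using \<omega> N(2) by blast
    then obtain T where T: "\<forall>t\<ge>T. \<phi> x t \<in> interior N" using omega_limit_in_open[OF open_interior] by blast
    then have stay: "\<forall>t\<ge>0. \<phi> (\<phi> x T) t \<in> interior N" by (simp add: flow_add)
    have "N \<inter> L \<subseteq> interior N" using N(2,3) by blast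
    from stays_or_attracted[OF N(1,4) this stay]
    obtain U where U: "open U" "\<phi> x T \<in> U"
      "\<forall>z\<in>U. (\<forall>t\<ge>0. \<phi> z t \<in> N) \<or> z \<in> attracted - K" by blast
    have "z \<in> basin_of_attraction \<phi> P \<union> (attracted - K)" if z: "\<phi> z T \<in> U" for z
    proof (cases "\<phi> z T \<in> attracted - K")
      case True
      then show ?thesis using invariant_iff[OF invariant_Diff[OF invariant_basin invariant_K]] by blast
    next
      case False
      then have stay: "\<forall>t\<ge>0. \<phi> (\<phi> z T) t \<in> N" using U(3) z by blast
      then have "\<phi> z T \<notin> attracted" using not_attracted_if_tail_avoids_K[OF N(1,4)] by blast
      then have "omega_limit \<phi> (\<phi> z T) \<subseteq> N \<inter> L"
        using omega_limit_subset_L omega_limit_subset_closed[OF N(1)] stay by blast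
      then show ?thesis using N(3) by (simp add: basin_iff omega_limit_shift)
    qed
    then have "{z. \<phi> z T \<in> U} \<subseteq> basin_of_attraction \<phi> P \<union> (attracted - K)" by blast
    then show ?thesis using open_flow_preimage[OF U(1)] U(2) by blast
  qed
qed

lemmas open_repelling_basin_clopen_part =
  isolated_non_saddle.open_basin_clopen_part[OF isolated_non_saddle_reverse, unfolded reverse_simps]

end


section \<open>Local connectedness of a compact absolute neighbourhood retract\<close>

lemma compact_metric_countable_dense:
  assumes "compact (UNIV :: 'a::metric_space set)"
  shows "\<exists>D::'a set. countable D \<and> (\<forall>x. \<forall>e>0. \<exists>d\<in>D. dist x d < e)"
proof -
  have "\<exists>F::'a set. finite F \<and> (\<forall>x. \<exists>d\<in>F. dist x d < 1 / real (Suc n))" for n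
  proof -
    obtain F :: "'a set" where F: "finite F" "UNIV \<subseteq> (\<Union>d\<in>F. ball d (1 / real (Suc n)))"
      using seq_compact_imp_totally_bounded[OF compact_imp_seq_compact[OF assms], rule_format, of "1 / real (Suc n)"] by auto
    have "\<exists>d\<in>F. dist x d < 1 / real (Suc n)" for x
      using subsetD[OF F(2), of x] by (auto simp: dist_commute)
    then show ?thesis using F(1) by blast
  qed
  then obtain F :: "nat \<Rightarrow> 'a set" where F: "\<And>n. finite (F n)"
    "\<And>n x. \<exists>d\<in>F n. dist x d < 1 / real (Suc n)" by metis
  have "\<exists>d\<in>\<Union>(range F). dist x d < e" if e: "e > 0" for x e
  proof -
    obtain n where n: "1 / real (Suc n) < e" using nat_approx_posE[OF e] by auto
    obtain d where "d \<in> F n" "dist x d < 1 / real (Suc n)" using F(2) by blast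
    then show ?thesis using n by (intro bexI[of _ d]) auto
  qed
  moreover have "countable (\<Union>(range F))" using F(1) by (simp add: countable_finite)
  ultimately show ?thesis by blast
qed

text \<open>
  The distances to a countable dense set \<open>D\<close> embed the compact space as a closed subset of the
  metrizable and locally connected space \<open>\<real>\<^sup>D\<close>; local connectedness passes to open subsets and
  to their retracts.
\<close>

lemma ANR_imp_locally_connected:
  assumes compact: "compact (UNIV :: 'a::metric_space set)"
    and ANR: "ANR_space (euclidean :: 'a topology)"
  shows "locally_connected_space (euclidean :: 'a topology)"
proof -
  obtain D :: "'a set" where D: "countable D" "\<And>x e. e > 0 \<Longrightarrow> \<exists>d\<in>D. dist x d < e"
    using compact_metric_countable_dense[OF compact] by blast
  let ?Z = "powertop_real D"
  define f :: "'a \<Rightarrow> 'a \<Rightarrow> real" where "f x = restrict (dist x) D" for x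
  have cont: "continuous_map euclidean ?Z f"
    unfolding continuous_map_componentwise
    by (auto simp: f_def intro!: continuous_intros)
  have "inj f"
  proof (rule injI, rule ccontr)
    fix x y assume eq: "f x = f y" and "x \<noteq> y"
    then obtain d where d: "d \<in> D" "dist x d < dist x y / 2"
      using D(2)[of "dist x y / 2" x] by auto
    have "dist x d = dist y d" using fun_cong[OF eq, of d] d(1) by (simp add: f_def)
    then show False using d(2) dist_triangle2[of x y d] by simp
  qed
  have haus: "Hausdorff_space ?Z" by (simp add: Hausdorff_space_product_topology)
  have "compact_space (euclidean :: 'a topology)" using compact by (simp add: compact_space_def)
  then have closed: "closed_map euclidean ?Z f"
    using continuous_imp_closed_map_gen[OF _ _ cont] haus by (simp add: Hausdorff_imp_kc_space)
  have clA: "closedin ?Z (range f)"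
    using closed unfolding closed_map_def by (metis closedin_topspace topspace_euclidean)
  have "embedding_map euclidean ?Z f"
    using injective_closed_imp_embedding_map[OF cont closed] \<open>inj f\<close> by simp
  then have hom: "(euclidean :: 'a topology) homeomorphic_space subtopology ?Z (range f)"
    using embedding_map_imp_homeomorphic_space by fastforce
  have "metrizable_space ?Z"
    using D(1) by (simp add: metrizable_space_product_topology metrizable_space_euclidean)
  then obtain U where U: "openin ?Z U" "range f \<subseteq> U"
    "range f retract_of_space subtopology ?Z U"
    using ANR clA hom unfolding ANR_space_def by meson
  have "locally_connected_space ?Z"
    using connectedin_topspace[of euclideanreal] connected_UNIV
    by (simp add: locally_connected_space_product_topology locally_connected_space_euclideanreal)
  then have "locally_connected_space (subtopology ?Z U)"
    using U(1) by (rule locally_connected_space_open_subset)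
  moreover obtain r where "retraction_map (subtopology ?Z U) (subtopology (subtopology ?Z U) (range f)) r"
    using U(3) unfolding retract_of_space_retraction_maps retraction_map_def by blast
  ultimately have "locally_connected_space (subtopology (subtopology ?Z U) (range f))"
    using locally_connected_space_retraction_map_image by blast
  moreover have "subtopology (subtopology ?Z U) (range f) = subtopology ?Z (range f)"
    using U(2) by (simp add: subtopology_subtopology Int_absorb1)
  ultimately show ?thesis using homeomorphic_locally_connected_space[OF hom] by simp
qed

lemma open_component_if_locally_connected:
  assumes "locally_connected_space (euclidean :: 'a::topological_space topology)" "open (U :: 'a set)"
  shows "open (connected_component_set U x)"
proof (cases "x \<in> U")
  case True
  have "open (connected_component_of_set (top_of_set U) x)"
    using assms True unfolding locally_connected_space_eq_open_connected_component_of by auto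
  moreover have "connected_component_of_set (top_of_set U) x = connected_component_set U x"
    by (auto simp: connected_component_of_def connected_component_def connectedin_subtopology)
  ultimately show ?thesis by simp
next
  case False
  then have empty: "connected_component_set U x = {}" by (blast dest: connected_component_in)
  show ?thesis unfolding empty by (rule open_empty)
qed


section \<open>Externally dissonant points and saddle components\<close>

context isolated_non_saddle
begin

text \<open>
  Points near \<open>x\<close> that come close to \<open>K\<close> at large positive and at large negative times are
  themselves attracted and repelled by \<open>K\<close>.
\<close>

lemma externally_dissonant_imp_closure_homoclinic:
  assumes "externally_dissonant \<phi> K x"
  shows "x \<in> L \<inter> closure homoclinic"
proof -
  have x: "x \<in> L" using assms by (simp add: externally_dissonant_def)
  obtain y z xs t s where yz: "y \<in> K" "z \<in> K" and xs: "xs \<longlonglongrightarrow> x"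
    and t: "filterlim t at_top sequentially" and s: "filterlim s at_bot sequentially"
    and ty: "(\<lambda>n. \<phi> (xs n) (t n)) \<longlonglongrightarrow> y" and sz: "(\<lambda>n. \<phi> (xs n) (s n)) \<longlonglongrightarrow> z"
    using assms by (auto simp: externally_dissonant_def J_star_def)
  have "x \<notin> K" using x L_disjoint_K by blast
  from attracted_if_returns[OF this]
  obtain U V \<tau> where UV: "open U" "x \<in> U" "open V" "K \<subseteq> V"
    "\<forall>y\<in>U. \<forall>t\<ge>\<tau>. \<phi> y t \<in> V \<longrightarrow> y \<in> attracted - K" by blast
  from isolated_non_saddle.attracted_if_returns[OF isolated_non_saddle_reverse \<open>x \<notin> K\<close>,
      unfolded reverse_simps reverse_flow_def]
  obtain U' V' \<tau>' where UV': "open U'" "x \<in> U'" "open V'" "K \<subseteq> V'"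
    "\<forall>y\<in>U'. \<forall>t\<ge>\<tau>'. \<phi> y (- t) \<in> V' \<longrightarrow> y \<in> repelled - K" by blast
  have "\<forall>\<^sub>F n in sequentially. xs n \<in> U" "\<forall>\<^sub>F n in sequentially. xs n \<in> U'"
    using topological_tendstoD[OF xs] UV UV' by blast+
  moreover have "\<forall>\<^sub>F n in sequentially. \<phi> (xs n) (t n) \<in> V"
    using topological_tendstoD[OF ty UV(3)] UV(4) yz(1) by blast
  moreover have "\<forall>\<^sub>F n in sequentially. \<phi> (xs n) (s n) \<in> V'"
    using topological_tendstoD[OF sz UV'(3)] UV'(4) yz(2) by blast
  moreover have "\<forall>\<^sub>F n in sequentially. \<tau> \<le> t n" using t by (simp add: filterlim_at_top)
  moreover have "\<forall>\<^sub>F n in sequentially. s n \<le> - \<tau>'" using s by (simp add: filterlim_at_bot)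
  ultimately have "\<forall>\<^sub>F n in sequentially. xs n \<in> closure homoclinic"
  proof eventually_elim
    case (elim n)
    have "xs n \<in> attracted - K" using UV(5)[rule_format, of "xs n" "t n"] elim by blast
    moreover have "\<tau>' \<le> - s n" "\<phi> (xs n) (- (- s n)) \<in> V'" using elim by simp_all
    then have "xs n \<in> repelled - K" using UV'(5) elim(2) by blast
    ultimately have "xs n \<in> homoclinic" unfolding homoclinic_iff by blast
    then show ?case by (rule subsetD[OF closure_subset])
  qed
  then have "x \<in> closure homoclinic"
    using xs by (intro Lim_in_closed_set[of "closure homoclinic" xs sequentially]) auto
  then show ?thesis using x by blast
qed

lemma attracted_approaches_K:
  assumes "x \<in> attracted" "e > 0"
  shows "\<exists>t\<ge>T. \<exists>p\<in>K. dist (\<phi> x t) p < e"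
proof -
  obtain p where p: "p \<in> omega_limit \<phi> x" using omega_limit_nonempty by blast
  then obtain t where "t \<ge> T" "\<phi> x t \<in> ball p e"
    using omega_limit_frequently[OF p, of "ball p e"] assms(2) by auto
  moreover have "p \<in> K" using p assms(1) by (auto simp: basin_iff)
  ultimately show ?thesis by (auto simp: dist_commute)
qed

lemmas repelled_approaches_K =
  isolated_non_saddle.attracted_approaches_K[OF isolated_non_saddle_reverse,
    unfolded reverse_simps reverse_flow_def]

text \<open>
  Along homoclinic points converging to \<open>x\<close>, times are chosen so large that the orbits are close to
  points of \<open>K\<close>; by compactness of \<open>K \<times> K\<close> a subsequence of these pairs of points converges.
\<close>

lemma closure_homoclinic_imp_externally_dissonant:
  assumes "x \<in> L" "x \<in> closure homoclinic"
  shows "externally_dissonant \<phi> K x"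
proof -
  obtain xs where xs: "\<And>n. xs n \<in> homoclinic" "xs \<longlonglongrightarrow> x"
    using assms(2) unfolding closure_sequential by blast
  have "\<exists>t\<ge>real n. \<exists>p\<in>K. dist (\<phi> (xs n) t) p < 1 / real (Suc n)" for n
    using attracted_approaches_K xs(1)[of n] unfolding homoclinic_iff by simp
  then obtain t p where t: "\<And>n. t n \<ge> real n" "\<And>n. p n \<in> K"
    "\<And>n. dist (\<phi> (xs n) (t n)) (p n) < 1 / real (Suc n)" by metis
  have "\<exists>s\<ge>real n. \<exists>q\<in>K. dist (\<phi> (xs n) (- s)) q < 1 / real (Suc n)" for n
    using repelled_approaches_K xs(1)[of n] unfolding homoclinic_iff by simp
  then obtain s q where s: "\<And>n. s n \<ge> real n" "\<And>n. q n \<in> K"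
    "\<And>n. dist (\<phi> (xs n) (- s n)) (q n) < 1 / real (Suc n)" by metis
  have "compact (K \<times> K)" using compact_Times compact_if_closed[OF closed_K] by blast
  then have "seq_compact (K \<times> K)" by (rule compact_imp_seq_compact)
  moreover have "\<forall>n. (p n, q n) \<in> K \<times> K" using t(2) s(2) by blast
  ultimately obtain l r where l: "l \<in> K \<times> K" and r: "strict_mono r"
    and lim: "((\<lambda>n. (p n, q n)) \<circ> r) \<longlonglongrightarrow> l" by (rule seq_compactE)
  have pq: "(\<lambda>n. p (r n)) \<longlonglongrightarrow> fst l" "(\<lambda>n. q (r n)) \<longlonglongrightarrow> snd l"
    using tendsto_fst[OF lim] tendsto_snd[OF lim] by (simp_all add: o_def)
  have small: "(\<lambda>n. 1 / real (Suc (r n))) \<longlonglongrightarrow> 0"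
    using LIMSEQ_subseq_LIMSEQ[OF LIMSEQ_Suc[OF lim_1_over_n] r] by (simp add: o_def)
  have close: "a \<longlonglongrightarrow> b" if "c \<longlonglongrightarrow> b" "\<And>n. dist (a n) (c n) < 1 / real (Suc (r n))"
    for a c :: "nat \<Rightarrow> 'a" and b
  proof (rule metric_tendsto_imp_tendsto)
    show "(\<lambda>n. 1 / real (Suc (r n)) + dist (c n) b) \<longlonglongrightarrow> 0"
      using tendsto_add[OF small tendsto_dist[OF that(1) tendsto_const[of b]]] by simp
    have "dist (a n) b \<le> 1 / real (Suc (r n)) + dist (c n) b" for n
      using dist_triangle[of "a n" b "c n"] that(2)[of n] by linarith
    then show "\<forall>\<^sub>F n in sequentially. dist (a n) b \<le> dist (1 / real (Suc (r n)) + dist (c n) b) 0"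
      by (simp add: order_trans[OF _ abs_ge_self])
  qed
  have grow: "filterlim (\<lambda>n. u (r n)) at_top sequentially" if "\<And>n. u n \<ge> real n" for u
  proof (rule filterlim_at_top_mono[OF filterlim_real_sequentially])
    have "real n \<le> u (r n)" for n
      using that[of "r n"] seq_suble[OF r, of n] by linarith
    then show "\<forall>\<^sub>F n in sequentially. real n \<le> u (r n)" by simp
  qed
  have "l \<in> J_star \<phi> x"
    unfolding J_star_def mem_Collect_eq case_prod_beta
  proof (intro exI conjI)
    show "(\<lambda>n. xs (r n)) \<longlonglongrightarrow> x" using LIMSEQ_subseq_LIMSEQ[OF xs(2) r] by (simp add: o_def)
    show "filterlim (\<lambda>n. t (r n)) at_top sequentially" using grow t(1) by blast
    show "filterlim (\<lambda>n. - s (r n)) at_bot sequentially"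
      using grow[of s] s(1) by (simp add: filterlim_uminus_at_bot)
    show "(\<lambda>n. \<phi> (xs (r n)) (t (r n))) \<longlonglongrightarrow> fst l" using t(3) by (intro close[OF pq(1)])
    show "(\<lambda>n. \<phi> (xs (r n)) (- s (r n))) \<longlonglongrightarrow> snd l" using s(3) by (intro close[OF pq(2)])
  qed
  then show ?thesis using l assms(1) by (auto simp: externally_dissonant_def)
qed

text \<open>
  Homoclinic points near \<open>C\<close> run into a neighbourhood of \<open>K\<close> in both time directions.
\<close>

lemma saddle_if_meets_closure_homoclinic:
  assumes C: "compact C" "invariant \<phi> C" "C \<subseteq> L" "C \<inter> closure homoclinic \<noteq> {}"
  shows "saddle \<phi> C"
proof -
  obtain U V where UV: "open U" "open V" "L \<subseteq> U" "K \<subseteq> V" "U \<inter> V = {}"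
    using t4_space[OF closed_L closed_K L_disjoint_K] by blast
  have leaves: "\<exists>x\<in>W. \<not> pos_orbit \<phi> x \<subseteq> U \<and> \<not> neg_orbit \<phi> x \<subseteq> U"
    if W: "neighbourhood_of C W" for W
  proof -
    obtain c where c: "c \<in> closure homoclinic" "c \<in> interior W"
      using C(4) W by (auto simp: neighbourhood_of_def)
    then obtain h where h: "h \<in> homoclinic" "h \<in> interior W"
      using closure_iff_nhds_not_empty[of c homoclinic] open_interior by blast
    have "omega_limit \<phi> h \<subseteq> V" using h(1) UV(4) by (auto simp: homoclinic_iff basin_iff)
    then obtain T where T: "\<forall>t\<ge>T. \<phi> h t \<in> V" using omega_limit_in_open[OF UV(2)] by blast
    have "\<phi> h (max T 0) \<notin> U" "max T 0 \<ge> 0" using T UV(5) by auto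
    then have "\<not> pos_orbit \<phi> h \<subseteq> U" unfolding pos_orbit_iff by blast
    have "omega_star_limit \<phi> h \<subseteq> V"
      using h(1) UV(4) by (auto simp: homoclinic_iff basin_of_repulsion_def)
    from compact_flow.omega_limit_in_open[OF compact_flow_reverse UV(2), unfolded reverse_simps, OF this]
    obtain T' where T': "\<forall>t\<ge>T'. \<phi> h (- t) \<in> V" unfolding reverse_flow_def by blast
    have "\<phi> h (- max T' 0) \<in> V" using T' by simp
    then have "\<phi> h (- max T' 0) \<notin> U" "- max T' 0 \<le> 0" using UV(5) by auto
    then have "\<not> neg_orbit \<phi> h \<subseteq> U" unfolding neg_orbit_iff by blast
    with \<open>\<not> pos_orbit \<phi> h \<subseteq> U\<close> show ?thesis using subsetD[OF interior_subset h(2)] by blast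
  qed
  have "neighbourhood_of C U" using UV(1,3) C(3) by (simp add: neighbourhood_of_def interior_open)
  then show ?thesis unfolding saddle_def using C(1,2) leaves by blast
qed

text \<open>
  A point near \<open>C\<close> that leaves a small neighbourhood \<open>N\<close> in both time directions is both attracted
  and repelled by \<open>K\<close>, hence homoclinic. The hypothesis \<open>base\<close> serves to choose \<open>N\<close> inside the
  given neighbourhood and with \<open>N \<inter> L \<subseteq> interior N\<close>; it holds for components of \<open>L\<close> and for open
  and closed parts of \<open>L\<close>.
\<close>

lemma not_saddle_if_avoids_closure_homoclinic:
  assumes disj: "C \<inter> closure homoclinic = {}"
    and base: "\<And>W. open W \<Longrightarrow> C \<subseteq> W \<Longrightarrow> \<exists>P. clopen_part L P \<and> C \<subseteq> P \<and> P \<subseteq> W"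
  shows "\<not> saddle \<phi> C"
proof
  assume "saddle \<phi> C"
  then obtain U where U: "neighbourhood_of C U" and leaves: "\<And>V. neighbourhood_of C V \<Longrightarrow>
    \<exists>x\<in>V. \<not> pos_orbit \<phi> x \<subseteq> U \<and> \<not> neg_orbit \<phi> x \<subseteq> U" unfolding saddle_def by blast
  obtain P where P: "clopen_part L P" "C \<subseteq> P" "P \<subseteq> interior U"
    using base[of "interior U"] U by (auto simp: neighbourhood_of_def)
  obtain N where N: "closed N" "P \<subseteq> interior N" "N \<subseteq> interior U" "N \<inter> L = P" "N \<inter> K = {}"
    using clopen_part_neighbourhood[OF P(1) open_interior P(3)] by blast
  have NL: "N \<inter> L \<subseteq> interior N" using N(2,4) by blast
  define V where "V = {x. (\<forall>t\<ge>0. \<phi> x t \<in> N) \<or> x \<in> attracted - K}"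
  define V' where "V' = {x. (\<forall>t\<ge>0. \<phi> x (- t) \<in> N) \<or> x \<in> repelled - K}"
  have "x \<in> interior V \<and> x \<in> interior V'" if "x \<in> C" for x
  proof -
    have orbit: "\<phi> x t \<in> interior N" for t
      using invariant_clopen_part[OF P(1)] that P(2) N(2) by (auto simp: invariant_def)
    have "\<forall>t\<ge>0. \<phi> x t \<in> interior N" using orbit by blast
    from stays_or_attracted[OF N(1,5) NL this]
    obtain W where W: "open W" "x \<in> W" "\<forall>z\<in>W. (\<forall>t\<ge>0. \<phi> z t \<in> N) \<or> z \<in> attracted - K"
      by blast
    have "\<forall>t\<ge>0. \<phi> x (- t) \<in> interior N" using orbit by blast
    from stays_or_repelled[OF N(1,5) NL this]
    obtain W' where W': "open W'" "x \<in> W'"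
      "\<forall>z\<in>W'. (\<forall>t\<ge>0. \<phi> z (- t) \<in> N) \<or> z \<in> repelled - K" by blast
    have "W \<subseteq> V" "W' \<subseteq> V'" using W(3) W'(3) by (auto simp: V_def V'_def)
    then show ?thesis using W W' by (meson interiorI)
  qed
  then have "neighbourhood_of C (interior V \<inter> interior V' \<inter> - closure homoclinic)"
    using disj by (auto simp: neighbourhood_of_def interior_open open_Int open_Compl subset_iff)
  from leaves[OF this] obtain x where x: "x \<in> interior V" "x \<in> interior V'" "x \<notin> closure homoclinic"
    "\<not> pos_orbit \<phi> x \<subseteq> U" "\<not> neg_orbit \<phi> x \<subseteq> U" by blast
  have NU: "N \<subseteq> U" using N(3) interior_subset by blast
  have "\<not> (\<forall>t\<ge>0. \<phi> x t \<in> N)" using x(4) NU unfolding pos_orbit_iff by blast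
  then have "x \<in> attracted - K" using subsetD[OF interior_subset x(1)] unfolding V_def by blast
  moreover obtain t where t: "t \<le> 0" "\<phi> x t \<notin> N" using x(5) NU unfolding neg_orbit_iff by blast
  then have "- t \<ge> 0" "\<phi> x (- (- t)) \<notin> N" by simp_all
  then have "\<not> (\<forall>t\<ge>0. \<phi> x (- t) \<in> N)" by blast
  then have "x \<in> repelled - K" using subsetD[OF interior_subset x(2)] unfolding V'_def by blast
  ultimately have "x \<in> homoclinic" unfolding homoclinic_iff by blast
  then show False using x(3) subsetD[OF closure_subset] by blast
qed

lemma component_of_L:
  assumes "C \<in> components L"
  shows "compact C" "invariant \<phi> C" "C \<subseteq> L"
proof -
  show sub: "C \<subseteq> L" by (rule in_components_subset[OF assms])
  show "compact C" using closed_components[OF closed_L assms] by (rule compact_if_closed)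
  show "invariant \<phi> C"
    unfolding invariant_def
  proof (intro ballI allI)
    fix x t assume x: "x \<in> C"
    have "range (\<phi> x) \<subseteq> L" using x sub invariant_L by (auto simp: invariant_def)
    moreover have "x \<in> range (\<phi> x)" using rangeI[of "\<phi> x" 0] by simp
    ultimately have "range (\<phi> x) \<subseteq> C"
      using components_maximal[OF assms connected_orbit[OF connected_UNIV]] x by blast
    then show "\<phi> x t \<in> C" by blast
  qed
qed

lemma saddle_component_iff:
  assumes "C \<in> components L"
  shows "saddle \<phi> C \<longleftrightarrow> C \<inter> closure homoclinic \<noteq> {}"
proof
  show "saddle \<phi> C" if "C \<inter> closure homoclinic \<noteq> {}"
    using saddle_if_meets_closure_homoclinic[OF component_of_L[OF assms] that] .
  show "C \<inter> closure homoclinic \<noteq> {}" if "saddle \<phi> C"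
  proof
    assume "C \<inter> closure homoclinic = {}"
    then have "\<not> saddle \<phi> C"
      by (rule not_saddle_if_avoids_closure_homoclinic)
        (rule component_clopen_part[OF compact_if_closed[OF closed_L] assms])
    then show False using that by blast
  qed
qed

lemma externally_dissonant_iff: "externally_dissonant \<phi> K x \<longleftrightarrow> x \<in> L \<inter> closure homoclinic"
proof
  show "x \<in> L \<inter> closure homoclinic" if "externally_dissonant \<phi> K x"
    by (rule externally_dissonant_imp_closure_homoclinic[OF that])
  show "externally_dissonant \<phi> K x" if "x \<in> L \<inter> closure homoclinic"
    by (rule closure_homoclinic_imp_externally_dissonant[OF IntD1[OF that] IntD2[OF that]])
qed

lemma saddle_components_eq:
  "saddle_components \<phi> L = {C \<in> components L. \<exists>x\<in>C. externally_dissonant \<phi> K x}"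
proof -
  have "saddle \<phi> C \<longleftrightarrow> (\<exists>x\<in>C. externally_dissonant \<phi> K x)" if "C \<in> components L" for C
    using saddle_component_iff[OF that] component_of_L(3)[OF that]
    by (auto simp: externally_dissonant_iff)
  then show ?thesis by (auto simp: saddle_components_def)
qed

end


section \<open>Basins of the parts of L without dissonant points\<close>

context isolated_non_saddle
begin

text \<open>
  Points outside \<open>P\<close> whose orbits tend to \<open>P\<close> are repelled by \<open>K\<close>, and so are the points near
  them. If such a nearby point did not tend to \<open>P\<close>, it would be attracted by \<open>K\<close>, that is, it would
  be homoclinic with an orbit passing close to \<open>P\<close>; there are no homoclinic points there. Hence the
  basin without \<open>P\<close> is open and closed in \<open>influence - K\<close>.
\<close>

lemma basin_clopen_part_separated:
  assumes P: "clopen_part L P" "P \<inter> closure homoclinic = {}"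
  shows "basin_of_attraction \<phi> P - P \<subseteq> influence - K"
    and "(basin_of_attraction \<phi> P - P) \<inter> homoclinic = {}"
    and "open (basin_of_attraction \<phi> P - P)"
    and "open (influence - K - (basin_of_attraction \<phi> P - P))"
proof -
  let ?B = "basin_of_attraction \<phi> P - P"
  have PL: "P \<subseteq> L" using P(1) by (simp add: clopen_part_def)
  have disj: "omega_limit \<phi> x \<subseteq> P \<Longrightarrow> omega_limit \<phi> x \<subseteq> Q \<Longrightarrow> P \<inter> Q = {} \<Longrightarrow> False" for x Q
    using omega_limit_nonempty[of x] by blast
  have not_attracted: "x \<notin> attracted" if "x \<in> ?B" for x
  proof
    assume "x \<in> attracted"
    then have "omega_limit \<phi> x \<subseteq> K" by (simp add: basin_iff)
    moreover have "P \<inter> K = {}" using PL L_disjoint_K by blast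
    ultimately show False using disj[of x K] that by (simp add: basin_iff)
  qed
  have repelled: "x \<in> repelled - K" if x: "x \<in> ?B" for x
  proof -
    have "x \<notin> L"
    proof
      assume "x \<in> L"
      then have "x \<in> L - P" using x by blast
      moreover have "clopen_part L (L - P)" using clopen_part_Compl[OF P(1)] .
      ultimately have "omega_limit \<phi> x \<subseteq> L - P"
        by (intro omega_limit_subset_invariant invariant_clopen_part) (simp_all add: clopen_part_def)
      then show False using disj[of x "L - P"] x by (auto simp: basin_iff)
    qed
    then show ?thesis using not_attracted[OF x] K_subset_attracted by (auto simp: influence_iff)
  qed
  show sub: "?B \<subseteq> influence - K" using repelled by (auto simp: influence_iff)
  show "?B \<inter> homoclinic = {}" using not_attracted by (auto simp: homoclinic_iff)
  show "open ?B"
  proof (rule topological_space_class.openI)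
    fix x assume x: "x \<in> ?B"
    have "omega_limit \<phi> x \<subseteq> - closure homoclinic" using x P(2) by (auto simp: basin_iff)
    then obtain T where T: "\<forall>t\<ge>T. \<phi> x t \<in> - closure homoclinic"
      using omega_limit_in_open[of "- closure homoclinic"] by blast
    let ?W = "(basin_of_attraction \<phi> P \<union> (attracted - K)) \<inter> (repelled - K) \<inter>
      {z. \<phi> z T \<in> - closure homoclinic}"
    have "open {z. \<phi> z T \<in> - closure homoclinic}" by (intro open_flow_preimage open_Compl closed_closure)
    then have "open ?W" using open_basin_clopen_part[OF P(1)] open_repelled by (intro open_Int)
    moreover have "x \<in> ?W" using x repelled[OF x] T by blast
    moreover have "?W \<subseteq> ?B"
    proof
      fix z assume z: "z \<in> ?W"
      have "z \<notin> attracted - K"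
      proof
        assume "z \<in> attracted - K"
        then have "\<phi> z T \<in> attracted - K"
          using invariant_iff[OF invariant_Diff[OF invariant_basin invariant_K]] by blast
        moreover have "\<phi> z T \<in> repelled - K"
        proof -
          have "invariant \<phi> (repelled - K)"
            using compact_flow.invariant_basin[OF compact_flow_reverse, of K, unfolded reverse_simps]
              invariant_K by (rule invariant_Diff)
          then show ?thesis using z invariant_iff by blast
        qed
        ultimately have "\<phi> z T \<in> homoclinic" unfolding homoclinic_iff by blast
        then show False using z subsetD[OF closure_subset] by blast
      qed
      moreover have "z \<notin> P" using z PL by (auto simp: influence_iff)
      ultimately show "z \<in> ?B" using z by blast
    qed
    ultimately show "\<exists>T. open T \<and> x \<in> T \<and> T \<subseteq> ?B" by blast
  qed
  have "influence - K - ?B =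
    influence \<inter> - K \<inter> (basin_of_attraction \<phi> (L - P) \<union> (attracted - K))" (is "?l = ?r")
  proof
    show "?l \<subseteq> ?r"
    proof
      fix x assume x: "x \<in> ?l"
      then have "x \<notin> P" using PL by blast
      then have "\<not> omega_limit \<phi> x \<subseteq> P" using x by (simp add: basin_iff)
      then have "omega_limit \<phi> x \<subseteq> K \<or> omega_limit \<phi> x \<subseteq> L - P"
        using omega_limit_cases[OF P(1), of x] by blast
      then show "x \<in> ?r" using x by (auto simp: basin_iff)
    qed
    show "?r \<subseteq> ?l"
    proof
      fix x assume x: "x \<in> ?r"
      have "x \<notin> ?B"
      proof
        assume B: "x \<in> ?B"
        then have "omega_limit \<phi> x \<subseteq> L - P" using x not_attracted by (auto simp: basin_iff)
        then show False using disj[of x "L - P"] B by (auto simp: basin_iff)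
      qed
      then show "x \<in> ?l" using x by blast
    qed
  qed
  moreover have "open ?r"
    using open_influence closed_K open_basin_clopen_part[OF clopen_part_Compl[OF P(1)]]
    by (intro open_Int open_Compl)
  ultimately show "open ?l" by simp
qed

lemmas repelling_basin_clopen_part_separated =
  isolated_non_saddle.basin_clopen_part_separated[OF isolated_non_saddle_reverse,
    unfolded reverse_simps]

text \<open>
  Points near \<open>P\<close> tend to \<open>P\<close> in one time direction, for otherwise they would be homoclinic. So if
  both basins were contained in \<open>P\<close>, then \<open>P\<close> would be open and closed in the connected phase space.
\<close>

lemma basin_clopen_part_nonempty:
  assumes conn: "connected (UNIV :: 'a set)"
    and P: "clopen_part L P" "P \<inter> closure homoclinic = {}" "P \<noteq> {}"
  shows "basin_of_attraction \<phi> P - P \<noteq> {} \<or> basin_of_repulsion \<phi> P - P \<noteq> {}"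
proof (rule ccontr)
  assume neg: "\<not> ?thesis"
  let ?G = "(basin_of_attraction \<phi> P \<union> (attracted - K)) \<inter> (basin_of_repulsion \<phi> P \<union> (repelled - K)) \<inter>
    - closure homoclinic"
  have "open ?G"
    using open_basin_clopen_part[OF P(1)] open_repelling_basin_clopen_part[OF P(1)]
    by (intro open_Int open_Compl closed_closure)
  have closed: "closed P" using P(1) by (simp add: clopen_part_def)
  have inv: "invariant \<phi> P" using invariant_clopen_part[OF P(1)] .
  have "P \<subseteq> basin_of_attraction \<phi> P"
    using omega_limit_subset_invariant[OF closed inv] by (auto simp: basin_iff)
  moreover have "P \<subseteq> basin_of_repulsion \<phi> P"
    using compact_flow.omega_limit_subset_invariant[OF compact_flow_reverse closed, unfolded reverse_simps, OF inv]
      compact_flow.basin_iff[OF compact_flow_reverse, unfolded reverse_simps] by blast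
  moreover have "(attracted - K) \<inter> (repelled - K) \<subseteq> closure homoclinic"
    using subsetD[OF closure_subset, of _ homoclinic] by (auto simp: homoclinic_iff)
  ultimately have "?G = P" using neg P(2) by blast
  then have "open P" using \<open>open ?G\<close> by simp
  then have "P = {} \<or> P = UNIV" using connected_clopen[of UNIV] conn closed by auto
  moreover have "P \<inter> K = {}" using P(1) L_disjoint_K by (auto simp: clopen_part_def)
  ultimately show False using P(3) nonempty by blast
qed


section \<open>Finitely many components in the region of influence\<close>

text \<open>
  The compact set consists of the points outside the interior of an isolating neighbourhood \<open>N\<close>
  whose whole past lies in \<open>N\<close>. Having that past, they are repelled by \<open>K\<close>; and the orbit of any
  point repelled by \<open>K\<close>, followed from the remote past on, reaches such a point when it first leaves
  the interior of \<open>N\<close>.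
\<close>

lemma compact_section_repelled:
  "\<exists>S. compact S \<and> S \<subseteq> repelled - K \<and> (\<forall>x\<in>repelled - K. \<exists>t. \<phi> x t \<in> S)"
proof -
  obtain N where N: "isolating_neighbourhood \<phi> K N" "closed N" "K \<subseteq> interior N"
    by (rule ex_isolating_neighbourhood)
  define S where "S = (\<Inter>s\<in>{0..}. {y. \<phi> y (- s) \<in> N}) - interior N"
  have "closed S" unfolding S_def
    by (intro closed_Diff closed_INT ballI closed_flow_preimage N(2) open_interior)
  then have "compact S" by (rule compact_if_closed)
  moreover have "S \<subseteq> repelled - K"
  proof
    fix y assume y: "y \<in> S"
    then have "\<forall>s\<ge>0. \<phi> y (- s) \<in> N" by (auto simp: S_def)
    then have "y \<in> repelled" by (rule repelled_if_neg_orbit_in_isolating[OF N(1)])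
    then show "y \<in> repelled - K" using y N(3) by (auto simp: S_def)
  qed
  moreover have "\<exists>t. \<phi> x t \<in> S" if x: "x \<in> repelled - K" for x
  proof -
    have "omega_star_limit \<phi> x \<subseteq> interior N" using x N(3) by (auto simp: basin_of_repulsion_def)
    from compact_flow.omega_limit_in_open[OF compact_flow_reverse open_interior,
        unfolded reverse_simps, OF this]
    obtain T where T: "\<forall>t\<ge>T. \<phi> x (- t) \<in> interior N" unfolding reverse_flow_def by blast
    obtain \<tau> where \<tau>: "\<phi> x \<tau> \<notin> N" using x in_K_if_orbit_in_isolating[OF N(1)] by blast
    let ?z = "\<phi> x (- T)"
    have "\<tau> > - T"
    proof (rule ccontr)
      assume "\<not> \<tau> > - T"
      then have "\<phi> x (- (- \<tau>)) \<in> interior N" using T by (intro T[rule_format]) simp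
      then show False using \<tau> interior_subset[of N] by auto
    qed
    then have "T + \<tau> \<ge> 0" "\<phi> ?z (T + \<tau>) \<notin> N" using \<tau> by (simp_all add: flow_add)
    moreover have "?z \<in> interior N" using T by simp
    ultimately obtain t where t: "0 \<le> t" "\<forall>r\<in>{0..t}. \<phi> ?z r \<in> N" "\<phi> ?z t \<notin> interior N"
      using first_exit[OF N(2)] by blast
    have "\<phi> (\<phi> ?z t) (- s) \<in> N" if "s \<ge> 0" for s
    proof (cases "s \<le> t")
      case True
      then have "t - s \<in> {0..t}" using that by auto
      from t(2)[rule_format, OF this] show ?thesis by (simp add: flow_add algebra_simps)
    next
      case False
      then have "\<phi> x (- (T + s - t)) \<in> interior N" by (intro T[rule_format]) simp
      then show ?thesis using interior_subset[of N] by (auto simp: flow_add algebra_simps)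
    qed
    then have "\<phi> x (- T + t) \<in> S" using t(3) by (auto simp: S_def flow_add)
    then show ?thesis by blast
  qed
  ultimately show ?thesis by blast
qed

lemmas compact_section_attracted =
  isolated_non_saddle.compact_section_repelled[OF isolated_non_saddle_reverse,
    unfolded reverse_simps reverse_flow_def]

text \<open>
  Local connectedness enters here: the components of \<open>influence - K\<close> are open, so finitely many of
  them cover the compact sections. A set that is open and closed in \<open>influence - K\<close> contains with a
  point its orbit, hence a point of a section, hence one of these finitely many components.
\<close>

lemma finite_set_meeting_clopen:
  assumes lc: "locally_connected_space (euclidean :: 'a topology)"
  shows "\<exists>F. finite F \<and> (\<forall>B. B \<subseteq> influence - K \<and> open B \<and> open (influence - K - B) \<and> B \<noteq> {} \<longrightarrow>
    B \<inter> F \<noteq> {})"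
proof -
  let ?G = "influence - K"
  obtain S where S: "compact S" "S \<subseteq> repelled - K" "\<forall>x\<in>repelled - K. \<exists>t. \<phi> x t \<in> S"
    using compact_section_repelled by blast
  obtain S' where S': "compact S'" "S' \<subseteq> attracted - K" "\<forall>x\<in>attracted - K. \<exists>t. \<phi> x (- t) \<in> S'"
    using compact_section_attracted by blast
  have sub: "S \<union> S' \<subseteq> ?G" using S(2) S'(2) by (auto simp: influence_iff)
  have "open ?G" using open_influence closed_K by (rule open_Diff)
  then have "open (connected_component_set ?G x)" for x
    by (rule open_component_if_locally_connected[OF lc])
  moreover have "S \<union> S' \<subseteq> (\<Union>x\<in>S \<union> S'. connected_component_set ?G x)"
    using sub connected_component_refl[of _ ?G] by blast
  moreover have "compact (S \<union> S')" using S(1) S'(1) by (rule compact_Un)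
  ultimately obtain F where F: "F \<subseteq> S \<union> S'" "finite F"
    "S \<union> S' \<subseteq> (\<Union>x\<in>F. connected_component_set ?G x)"
    using compactE_image[of "S \<union> S'" "S \<union> S'" "connected_component_set ?G"] by metis
  have meets: "B \<inter> F \<noteq> {}"
    if B: "B \<subseteq> ?G" "open B" "open (?G - B)" "B \<noteq> {}" for B
  proof -
    have closed_under: "C \<subseteq> B" if C: "connected C" "C \<subseteq> ?G" "y \<in> C" "y \<in> B" for C y
    proof -
      have "B \<inter> C = {} \<or> (?G - B) \<inter> C = {}"
        using connectedD[OF C(1) B(2,3)] C(2) by blast
      then show ?thesis using C by blast
    qed
    obtain x where x: "x \<in> B" using B(4) by blast
    have "x \<in> repelled - K \<or> x \<in> attracted - K" using subsetD[OF B(1) x] by (auto simp: influence_iff)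
    then obtain t where t: "\<phi> x t \<in> S \<union> S'" using bspec[OF S(3)] bspec[OF S'(3)] by blast
    have "range (\<phi> x) \<subseteq> ?G"
      using x B(1) invariant_Diff[OF invariant_influence invariant_K] by (auto simp: invariant_def)
    then have "range (\<phi> x) \<subseteq> B"
      using closed_under[OF connected_orbit[OF connected_UNIV], of x x] x rangeI[of "\<phi> x" 0] by simp
    then have "\<phi> x t \<in> B" by blast
    moreover obtain p where p: "p \<in> F" "connected_component ?G p (\<phi> x t)" using F(3) t by blast
    ultimately have "connected_component_set ?G p \<subseteq> B"
      using closed_under[OF connected_connected_component connected_component_subset] by blast
    moreover have "p \<in> connected_component_set ?G p"
      using p(2) connected_component_in connected_component_refl by fastforce
    ultimately show ?thesis using p(1) by blast
  qed
  then show ?thesis using F(2) by blast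
qed

text \<open>
  The union of the non-saddle components of \<open>L\<close>, expressed by homoclinic points.
\<close>

definition non_dissonant_part :: "'a set" where
  "non_dissonant_part = L - \<Union> {C \<in> components L. C \<inter> closure homoclinic \<noteq> {}}"

lemma non_dissonant_part_disjoint: "non_dissonant_part \<inter> closure homoclinic = {}"
proof -
  have "c \<notin> non_dissonant_part" if c: "c \<in> closure homoclinic" for c
  proof
    assume "c \<in> non_dissonant_part"
    then have L: "c \<in> L" and nd: "\<And>C. C \<in> components L \<Longrightarrow> c \<in> C \<Longrightarrow> C \<inter> closure homoclinic = {}"
      by (auto simp: non_dissonant_part_def)
    obtain C where "C \<in> components L" "c \<in> C" using in_some_component[OF L] by blast
    then show False using nd c by blast
  qed
  then show ?thesis by blast
qed

lemma non_dissonant_part_nbhd: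
  assumes "c \<in> non_dissonant_part"
  shows "\<exists>P. clopen_part L P \<and> c \<in> P \<and> P \<subseteq> non_dissonant_part"
proof -
  have "c \<in> L" using assms by (simp add: non_dissonant_part_def)
  then obtain C where C: "C \<in> components L" "c \<in> C" using in_some_component by blast
  then have "C \<subseteq> - closure homoclinic" using assms by (auto simp: non_dissonant_part_def)
  moreover have "open (- closure homoclinic)" by (intro open_Compl closed_closure)
  ultimately obtain P where P: "clopen_part L P" "C \<subseteq> P" "P \<subseteq> - closure homoclinic"
    using component_clopen_part[OF compact_if_closed[OF closed_L] C(1)] by metis
  have "x \<in> non_dissonant_part" if x: "x \<in> P" for x
  proof -
    have "x \<notin> D" if D: "D \<in> components L" "D \<inter> closure homoclinic \<noteq> {}" for D
    proof
      assume "x \<in> D"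
      then have "D \<subseteq> P"
        using connected_subset_clopen_part[OF P(1) in_components_connected[OF D(1)]
            in_components_subset[OF D(1)]] x by blast
      then show False using D(2) P(3) by blast
    qed
    moreover have "x \<in> L" using x P(1) by (auto simp: clopen_part_def)
    ultimately show ?thesis by (auto simp: non_dissonant_part_def)
  qed
  then show ?thesis using P C(2) by blast
qed

text \<open>
  Every non-empty open and closed part inside \<open>non_dissonant_part\<close> has, in one of the two time
  directions, a basin that meets the finite set \<open>F\<close> of \<open>finite_set_meeting_clopen\<close>. So the parts
  that contain the limit sets of the points of \<open>F\<close> already exhaust \<open>non_dissonant_part\<close>, which is then a finite union of closed sets.
\<close>

lemma clopen_non_dissonant_part:
  assumes conn: "connected (UNIV :: 'a set)"
    and lc: "locally_connected_space (euclidean :: 'a topology)"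
  shows "clopen_part L non_dissonant_part"
proof -
  let ?Q = "non_dissonant_part"
  obtain F where F: "finite F" "\<And>B. B \<subseteq> influence - K \<Longrightarrow> open B \<Longrightarrow>
    open (influence - K - B) \<Longrightarrow> B \<noteq> {} \<Longrightarrow> B \<inter> F \<noteq> {}"
    using finite_set_meeting_clopen[OF lc] by metis
  interpret rev: isolated_non_saddle "reverse_flow \<phi>" K by (rule isolated_non_saddle_reverse)
  (* M stands for a forward or a backward limit set, which lies on one side of every partition. *)
  have part: "\<exists>P. clopen_part L P \<and> P \<subseteq> ?Q \<and> (M \<subseteq> ?Q \<longrightarrow> M \<subseteq> P)"
    if M: "\<And>P. clopen_part L P \<Longrightarrow> M \<subseteq> K \<or> M \<subseteq> P \<or> M \<subseteq> L - P" "M \<noteq> {}" for M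
  proof (cases "M \<subseteq> ?Q")
    case True
    obtain c where c: "c \<in> M" using M(2) by blast
    then obtain P where P: "clopen_part L P" "c \<in> P" "P \<subseteq> ?Q"
      using non_dissonant_part_nbhd True by blast
    have "c \<notin> K" using P L_disjoint_K by (auto simp: clopen_part_def)
    then have "M \<subseteq> P" using M(1)[OF P(1)] c P(2) by blast
    then show ?thesis using P by blast
  next
    case False
    then show ?thesis using clopen_part_empty[OF closed_L] by blast
  qed
  have "\<exists>P. clopen_part L P \<and> P \<subseteq> ?Q \<and> (omega_limit \<phi> q \<subseteq> ?Q \<longrightarrow> omega_limit \<phi> q \<subseteq> P)" for q
    by (rule part[OF omega_limit_cases omega_limit_nonempty])
  then obtain g where g: "\<And>q. clopen_part L (g q)" "\<And>q. g q \<subseteq> ?Q"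
    "\<And>q. omega_limit \<phi> q \<subseteq> ?Q \<Longrightarrow> omega_limit \<phi> q \<subseteq> g q" by metis
  have "\<exists>P. clopen_part L P \<and> P \<subseteq> ?Q \<and> (omega_star_limit \<phi> q \<subseteq> ?Q \<longrightarrow> omega_star_limit \<phi> q \<subseteq> P)" for q
    by (rule part[OF rev.omega_limit_cases[unfolded reverse_simps]
          rev.omega_limit_nonempty[unfolded reverse_simps]])
  then obtain g' where g': "\<And>q. clopen_part L (g' q)" "\<And>q. g' q \<subseteq> ?Q"
    "\<And>q. omega_star_limit \<phi> q \<subseteq> ?Q \<Longrightarrow> omega_star_limit \<phi> q \<subseteq> g' q" by metis
  define P where "P = (\<Union>q\<in>F. g q \<union> g' q)"
  have P: "clopen_part L P"
    unfolding P_def by (intro clopen_part_UN[OF closed_L F(1)] clopen_part_Un g(1) g'(1))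
  have "?Q \<subseteq> P"
  proof (rule ccontr)
    assume "\<not> ?Q \<subseteq> P"
    then obtain c where c: "c \<in> ?Q" "c \<notin> P" by blast
    obtain P' where P': "clopen_part L P'" "c \<in> P'" "P' \<subseteq> ?Q" using non_dissonant_part_nbhd[OF c(1)] by blast
    define P'' where "P'' = P' - P"
    have P'': "clopen_part L P''" "P'' \<noteq> {}" "P'' \<subseteq> ?Q" "P'' \<inter> P = {}"
      using clopen_part_Diff[OF P'(1) P] c(2) P'(2,3) by (auto simp: P''_def)
    have disj: "P'' \<inter> closure homoclinic = {}" using P''(3) non_dissonant_part_disjoint by blast
    consider "basin_of_attraction \<phi> P'' - P'' \<noteq> {}" | "basin_of_repulsion \<phi> P'' - P'' \<noteq> {}"
      using basin_clopen_part_nonempty[OF conn P''(1) disj P''(2)] by blast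
    then show False
    proof cases
      case 1
      then obtain q where q: "q \<in> F" "omega_limit \<phi> q \<subseteq> P''"
        using F(2)[OF basin_clopen_part_separated(1,3,4)[OF P''(1) disj]] by (auto simp: basin_iff)
      then have "omega_limit \<phi> q \<subseteq> P" using g(3)[of q] P''(3) by (auto simp: P_def)
      then show False using q(2) P''(4) omega_limit_nonempty[of q] by blast
    next
      case 2
      then obtain q where q: "q \<in> F" "omega_star_limit \<phi> q \<subseteq> P''"
        using F(2)[OF repelling_basin_clopen_part_separated(1,3,4)[OF P''(1) disj]]
        by (auto simp: basin_of_repulsion_def)
      then have "omega_star_limit \<phi> q \<subseteq> P" using g'(3)[of q] P''(3) by (auto simp: P_def)
      then show False using q(2) P''(4) rev.omega_limit_nonempty[of q, unfolded reverse_simps] by blast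
    qed
  qed
  moreover have "P \<subseteq> ?Q" using g(2) g'(2) by (auto simp: P_def)
  ultimately show ?thesis using P by (metis subset_antisym)
qed

text \<open>
  A point tending to \<open>Q\<close> lies in the basin of \<open>Q\<close>, which contains no homoclinic points and, being
  open and closed in \<open>influence - K\<close>, contains every component that it meets.
\<close>

lemma omega_limit_of_mixed_component:
  assumes Q: "clopen_part L Q" "Q \<inter> closure homoclinic = {}"
    and x: "x \<in> influence - K" "x \<notin> attracted"
    and mixed: "connected_component_set (influence - K) x \<inter> homoclinic \<noteq> {}"
  shows "omega_limit \<phi> x \<subseteq> L - Q"
proof (rule ccontr)
  assume neg: "\<not> omega_limit \<phi> x \<subseteq> L - Q"
  let ?B = "basin_of_attraction \<phi> Q - Q"
  let ?C = "connected_component_set (influence - K) x"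
  have "x \<in> ?B"
    using neg omega_limit_cases[OF Q(1), of x] x Q(1) by (auto simp: basin_iff clopen_part_def)
  moreover have "x \<in> ?C" using x(1) connected_component_refl[of x "influence - K"] by simp
  moreover have "?B \<inter> ?C = {} \<or> (influence - K - ?B) \<inter> ?C = {}"
    using connectedD[OF connected_connected_component basin_clopen_part_separated(3,4)[OF Q]]
      connected_component_subset[of "influence - K" x] by blast
  ultimately have "?C \<subseteq> ?B" using connected_component_subset[of "influence - K" x] by blast
  then show False using mixed basin_clopen_part_separated(2)[OF Q] by blast
qed

lemmas omega_star_limit_of_mixed_component =
  isolated_non_saddle.omega_limit_of_mixed_component[OF isolated_non_saddle_reverse,
    unfolded reverse_simps]

end


section \<open>The complement of the region of influence\<close>

theorem theorem29:
  fixes \<phi> :: "'a::metric_space \<Rightarrow> real \<Rightarrow> 'a"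
    and K L L\<^sub>s L\<^sub>n :: "'a set"
  assumes "compact (UNIV :: 'a set)"
    and "connected (UNIV :: 'a set)"
    and "ANR_space (euclidean :: 'a topology)"
    and "flow \<phi>"
    and "connected K"
    and "isolated_invariant \<phi> K"
    and "non_saddle \<phi> K"
    and "K \<noteq> {}"
    and "K \<noteq> UNIV"
    and "L = UNIV - region_of_influence \<phi> K"
    and "L\<^sub>s = \<Union> (saddle_components \<phi> L)"
    and "L\<^sub>n = L - L\<^sub>s"
  shows "(L \<noteq> {} \<longrightarrow> isolated_invariant \<phi> L) \<and>
    (\<not> unstable_global_attractor \<phi> K \<longrightarrow> L \<noteq> {}) \<and>
    saddle_components \<phi> L = {C \<in> components L. \<exists>x\<in>C. externally_dissonant \<phi> K x} \<and>
    (L\<^sub>s \<noteq> {} \<longrightarrow> isolated_invariant \<phi> L\<^sub>s \<and> saddle \<phi> L\<^sub>s) \<and>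
    (L\<^sub>n \<noteq> {} \<longrightarrow> isolated_invariant \<phi> L\<^sub>n \<and> non_saddle \<phi> L\<^sub>n) \<and>
    (\<forall>x \<in> region_of_influence \<phi> K - K.
       x \<notin> homoclinic_points \<phi> K \<and>
       connected_component_set (region_of_influence \<phi> K - K) x \<inter> homoclinic_points \<phi> K \<noteq> {} \<longrightarrow>
       omega_limit \<phi> x \<subseteq> L\<^sub>s \<or> omega_star_limit \<phi> x \<subseteq> L\<^sub>s)"
proof -
  interpret S: isolated_non_saddle \<phi> K
    using assms by unfold_locales
  note L = assms(10)
  have comps: "saddle_components \<phi> L = {C \<in> components L. C \<inter> closure S.homoclinic \<noteq> {}}"
    using S.saddle_component_iff by (auto simp: saddle_components_def L)
  have Ls_sub: "L\<^sub>s \<subseteq> L"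
    unfolding assms(11) comps using in_components_subset by blast
  have "L\<^sub>n = S.non_dissonant_part"
    unfolding assms(11,12) comps by (simp add: S.non_dissonant_part_def L)
  then have Ln: "clopen_part L L\<^sub>n" "L\<^sub>n \<inter> closure S.homoclinic = {}"
    using S.clopen_non_dissonant_part[OF assms(2) ANR_imp_locally_connected[OF assms(1,3)]]
      S.non_dissonant_part_disjoint by (simp_all add: L)
  have Ls_eq: "L\<^sub>s = L - L\<^sub>n" using Ls_sub assms(12) by blast
  have Ls: "clopen_part L L\<^sub>s" unfolding Ls_eq by (rule clopen_part_Compl[OF Ln(1)])
  have isolated: "isolated_invariant \<phi> P" if "clopen_part L P" for P
    using S.isolated_clopen_part that by (simp add: L)
  have "clopen_part L L" using clopen_part_Compl[OF clopen_part_empty[of L]] S.closed_L by (simp add: L)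
  then have 1: "isolated_invariant \<phi> L" by (rule isolated)
  have 2: "\<not> unstable_global_attractor \<phi> K \<longrightarrow> L \<noteq> {}"
    using S.L_nonempty[OF assms(9)] by (simp add: L)
  have 3: "saddle_components \<phi> L = {C \<in> components L. \<exists>x\<in>C. externally_dissonant \<phi> K x}"
    using S.saddle_components_eq by (simp add: L)
  have compact_invariant: "compact P" "invariant \<phi> P" if "clopen_part L P" for P
    using isolated[OF that] by (simp_all add: isolated_invariant_def)
  have 4: "saddle \<phi> L\<^sub>s" if nonempty: "L\<^sub>s \<noteq> {}"
  proof (rule S.saddle_if_meets_closure_homoclinic[OF compact_invariant[OF Ls]])
    show "L\<^sub>s \<subseteq> UNIV - region_of_influence \<phi> K" using Ls_sub by (simp add: L)
    show "L\<^sub>s \<inter> closure S.homoclinic \<noteq> {}" using nonempty unfolding assms(11) comps by blast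
  qed
  have 5: "non_saddle \<phi> L\<^sub>n"
  proof -
    have "\<not> saddle \<phi> L\<^sub>n"
      by (rule S.not_saddle_if_avoids_closure_homoclinic[OF Ln(2)]) (use Ln(1) L in blast)
    then show ?thesis using compact_invariant[OF Ln(1)] by (simp add: non_saddle_def)
  qed
  have 6: "omega_limit \<phi> x \<subseteq> L\<^sub>s \<or> omega_star_limit \<phi> x \<subseteq> L\<^sub>s"
    if x: "x \<in> S.influence - K" "x \<notin> S.homoclinic"
      and mixed: "connected_component_set (S.influence - K) x \<inter> S.homoclinic \<noteq> {}" for x
  proof -
    have "x \<notin> S.attracted \<or> x \<notin> S.repelled" using x by (auto simp: S.homoclinic_iff)
    then show ?thesis
      using S.omega_limit_of_mixed_component[OF Ln[unfolded L] x(1) _ mixed]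
        S.omega_star_limit_of_mixed_component[OF Ln[unfolded L] x(1) _ mixed]
      unfolding Ls_eq L by blast
  qed
  show ?thesis using 1 2 3 4 5 6 isolated[OF Ls] isolated[OF Ln(1)] by blast
qed

end
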